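(* Let $\mu,\nu,k$ be integers with $0\le k\le\mu<\nu$, and for $f\in C(\mathbb{CP}^1)$ let $E^\nu_{\mu,k}(f):=R_{\mu+\nu-2k}\big(\mathcal{T}^\nu_{\mu,k}(R_\mu^*(f))\big)$. Then $$E^\nu_{\mu,k}(f)=C_{\mu,\nu,k}^2\sum_{l=0}^k(-1)^{k-l}\binom{\nu-k}{k-l}\frac{(\nu-k+l)!\,k!}{\nu!\,l!}\,B_{\mu-l}(f).$$
   Context: For an integer $\tau\ge0$, $\mathcal{H}_\tau$ is the space of polynomials in one complex variable of degree $\le\tau$, with inner product $\langle f,g\rangle=\int_{\mathbb{C}}f\overline g\,d\iota_\tau$, $d\iota_\tau(z)=\frac{\tau+1}{(1+|z|^2)^\tau}\frac{dA(z)}{\pi(1+|z|^2)^2}$ ($dA$ Lebesgue measure); $d\iota:=d\iota_0$ (a probability measure). $\mathcal{H}_\tau$ has reproducing kernel $K^\tau(x,y)=(1+x\overline y)^\tau$; the kernel of an operator $\Gamma$ on $\mathcal{H}_\tau$ is $\Gamma(x,y):=\Gamma(K^\tau(\cdot,y))(x)$. $C(\mathbb{CP}^1)$ denotes continuous functions on $\mathbb{C}$ extending continuously to $\mathbb{C}\cup\{\infty\}$. Define $R_\tau(\Gamma)(z)=\Gamma(z,z)/(1+|z|^2)^\tau$ for $\Gamma\in B(\mathcal{H}_\tau)$; for a function $f$, $R_\tau^*(f)$ is the operator on $\mathcal{H}_\tau$ given by $(R_\tau^*(f)h)(x)=\frac1{\tau+1}\int_{\mathbb{C}}f(z)h(z)(1+x\overline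 z)^\tau d\iota_\tau(z)$; the Berezin transform is $B_\tau(f)(z)=R_\tau R_\tau^*(f)(z)=\int_{\mathbb{C}}\frac{|1+z\overline s|^{2\tau}}{(1+|z|^2)^\tau(1+|s|^2)^\tau}f(s)\,d\iota(s)$. $\mathcal{H}_\mu\otimes\mathcal{H}_\nu$ is realized as polynomials $F(z,w)$ of degree $\le\mu$ in $z$, $\le\nu$ in $w$, with inner product of $L^2(d\iota_\mu(z)d\iota_\nu(w))$. $J_k(F)(\xi)=\int_{\mathbb{C}^2}F(z,w)(\overline z-\overline w)^k(1+\xi\overline z)^{\mu-k}(1+\xi\overline w)^{\nu-k}d\iota_\mu(z)d\iota_\nu(w)$ maps into $\mathcal{H}_{\mu+\nu-2k}$; $C_{\mu,\nu,k}^2:=\frac{(-\nu)_k(-\mu)_k}{k!(\mu+\nu-2k+2)_k}$ (rising Pochhammer $(a)_n=a(a+1)\cdots(a+n-1)$), $C_{\mu,\nu,k}>0$; $P_k=C_{\mu,\nu,k}J_k$; $\mathcal{T}^\nu_{\mu,k}(A)=P_k(A\otimes I)P_k^*$ for $A\in B(\mathcal{H}_\mu)$, $I$ the identity of $\mathcal{H}_\nu$. *)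

theory Defs
  imports "HOL-Analysis.Analysis"
begin

definition iota_w :: "nat \<Rightarrow> complex \<Rightarrow> real" where
  "iota_w \<tau> z = real (\<tau> + 1) / (pi * (1 + (cmod z)^2) ^ (\<tau> + 2))"

definition int_iota :: "nat \<Rightarrow> (complex \<Rightarrow> complex) \<Rightarrow> complex" where
  "int_iota \<tau> g = (LINT z|lborel. complex_of_real (iota_w \<tau> z) * g z)"

definition int_iota2 :: "nat \<Rightarrow> nat \<Rightarrow> (complex \<Rightarrow> complex \<Rightarrow> complex) \<Rightarrow> complex" where
  "int_iota2 \<mu> \<nu> G = (LINT p|(lborel :: (complex \<times> complex) measure).
      complex_of_real (iota_w \<mu> (fst p) * iota_w \<nu> (snd p)) * G (fst p) (snd p))"

definition polys :: "nat \<Rightarrow> (complex \<Rightarrow> complex) set" where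
  "polys \<tau> = {h. \<exists>c. \<forall>z. h z = (\<Sum>i\<le>\<tau>. c i * z ^ i)}"

text \<open>H_mu tensor H_nu: polynomials of degree at most mu in z and at most nu in w.\<close>
definition tpolys :: "nat \<Rightarrow> nat \<Rightarrow> (complex \<Rightarrow> complex \<Rightarrow> complex) set" where
  "tpolys \<mu> \<nu> = {F. \<exists>c. \<forall>z w. F z w = (\<Sum>i\<le>\<mu>. \<Sum>j\<le>\<nu>. c i j * z ^ i * w ^ j)}"

definition inner_H :: "nat \<Rightarrow> (complex \<Rightarrow> complex) \<Rightarrow> (complex \<Rightarrow> complex) \<Rightarrow> complex" where
  "inner_H \<tau> f g = int_iota \<tau> (\<lambda>z. f z * cnj (g z))"

definition inner_T :: "nat \<Rightarrow> nat \<Rightarrow> (complex \<Rightarrow> complex \<Rightarrow> complex)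
    \<Rightarrow> (complex \<Rightarrow> complex \<Rightarrow> complex) \<Rightarrow> complex" where
  "inner_T \<mu> \<nu> F G = int_iota2 \<mu> \<nu> (\<lambda>z w. F z w * cnj (G z w))"

definition kern :: "nat \<Rightarrow> complex \<Rightarrow> complex \<Rightarrow> complex" where
  "kern \<tau> y = (\<lambda>x. (1 + x * cnj y) ^ \<tau>)"

text \<open>R_tau(Gamma)(z) = Gamma(z,z)/(1+|z|^2)^tau, with Gamma(x,y) = Gamma(K^tau(.,y))(x).\<close>
definition R_op :: "nat \<Rightarrow> ((complex \<Rightarrow> complex) \<Rightarrow> (complex \<Rightarrow> complex)) \<Rightarrow> complex \<Rightarrow> complex" where
  "R_op \<tau> \<Gamma> z = \<Gamma> (kern \<tau> z) z / complex_of_real ((1 + (cmod z)^2) ^ \<tau>)"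

definition Rstar :: "nat \<Rightarrow> (complex \<Rightarrow> complex) \<Rightarrow> (complex \<Rightarrow> complex) \<Rightarrow> (complex \<Rightarrow> complex)" where
  "Rstar \<tau> f h = (\<lambda>x. 1 / of_nat (\<tau> + 1) * int_iota \<tau> (\<lambda>z. f z * h z * (1 + x * cnj z) ^ \<tau>))"

definition berezin :: "nat \<Rightarrow> (complex \<Rightarrow> complex) \<Rightarrow> complex \<Rightarrow> complex" where
  "berezin \<tau> f z = int_iota 0 (\<lambda>s. complex_of_real
      ((cmod (1 + z * cnj s)) ^ (2 * \<tau>) / ((1 + (cmod z)^2) ^ \<tau> * (1 + (cmod s)^2) ^ \<tau>)) * f s)"

definition J_op :: "nat \<Rightarrow> nat \<Rightarrow> nat \<Rightarrow> (complex \<Rightarrow> complex \<Rightarrow> complex) \<Rightarrow> complex \<Rightarrow> complex" where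
  "J_op \<mu> \<nu> k F \<xi> = int_iota2 \<mu> \<nu> (\<lambda>z w. F z w * (cnj z - cnj w) ^ k
      * (1 + \<xi> * cnj z) ^ (\<mu> - k) * (1 + \<xi> * cnj w) ^ (\<nu> - k))"

definition Csq :: "nat \<Rightarrow> nat \<Rightarrow> nat \<Rightarrow> real" where
  "Csq \<mu> \<nu> k = pochhammer (- real \<nu>) k * pochhammer (- real \<mu>) k
      / (fact k * pochhammer (real (\<mu> + \<nu> - 2 * k + 2)) k)"

definition Cc :: "nat \<Rightarrow> nat \<Rightarrow> nat \<Rightarrow> real" where
  "Cc \<mu> \<nu> k = sqrt (Csq \<mu> \<nu> k)"

definition P_op :: "nat \<Rightarrow> nat \<Rightarrow> nat \<Rightarrow> (complex \<Rightarrow> complex \<Rightarrow> complex) \<Rightarrow> complex \<Rightarrow> complex" where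
  "P_op \<mu> \<nu> k F = (\<lambda>\<xi>. complex_of_real (Cc \<mu> \<nu> k) * J_op \<mu> \<nu> k F \<xi>)"

definition P_adj :: "nat \<Rightarrow> nat \<Rightarrow> nat \<Rightarrow> (complex \<Rightarrow> complex) \<Rightarrow> complex \<Rightarrow> complex \<Rightarrow> complex" where
  "P_adj \<mu> \<nu> k h = (THE G. G \<in> tpolys \<mu> \<nu> \<and>
      (\<forall>F\<in>tpolys \<mu> \<nu>. inner_H (\<mu> + \<nu> - 2 * k) (P_op \<mu> \<nu> k F) h = inner_T \<mu> \<nu> F G))"

definition tensorI :: "((complex \<Rightarrow> complex) \<Rightarrow> (complex \<Rightarrow> complex))
    \<Rightarrow> (complex \<Rightarrow> complex \<Rightarrow> complex) \<Rightarrow> complex \<Rightarrow> complex \<Rightarrow> complex" where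
  "tensorI A F = (\<lambda>z w. A (\<lambda>z'. F z' w) z)"

definition T_op :: "nat \<Rightarrow> nat \<Rightarrow> nat \<Rightarrow> ((complex \<Rightarrow> complex) \<Rightarrow> (complex \<Rightarrow> complex))
    \<Rightarrow> (complex \<Rightarrow> complex) \<Rightarrow> complex \<Rightarrow> complex" where
  "T_op \<mu> \<nu> k A h = P_op \<mu> \<nu> k (tensorI A (P_adj \<mu> \<nu> k h))"

definition E_op :: "nat \<Rightarrow> nat \<Rightarrow> nat \<Rightarrow> (complex \<Rightarrow> complex) \<Rightarrow> complex \<Rightarrow> complex" where
  "E_op \<mu> \<nu> k f = R_op (\<mu> + \<nu> - 2 * k) (T_op \<mu> \<nu> k (Rstar \<mu> f))"

definition C_CP1 :: "(complex \<Rightarrow> complex) set" where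
  "C_CP1 = {f. continuous_on UNIV f \<and> (\<exists>L. (f \<longlongrightarrow> L) at_infinity)}"

end

theory Submission
  imports Defs "HOL-Computational_Algebra.Polynomial"
begin

text \<open>
  By the reproducing property, \<open>P_k\<^sup>*\<close> maps the kernel function at \<open>\<xi>\<close> to \<open>C\<close> times
  \<open>G(z, w) = (z - w)\<^sup>k (1 + \<xi>\<^sup>* z)\<^bsup>\<mu> - k\<^esup> (1 + \<xi>\<^sup>* w)\<^bsup>\<nu> - k\<^esup>\<close> (where \<open>\<xi>\<^sup>*\<close> is the conjugate),
  so that \<open>E(f)(\<xi>)\<close> is an integral of \<open>f(s)\<close> against the squared norm of \<open>G(s, \<cdot>)\<close> in \<open>H\<^sub>\<nu>\<close>.
  Pairing \<open>G(s, \<cdot>)\<close> with the \<open>\<nu>\<close>-th powers \<open>((1 + \<xi>\<^sup>* w) + t (s - w))\<^sup>\<nu>\<close> and comparing the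
  coefficients of \<open>t\<^sup>k\<close> gives this norm as a polynomial in \<open>|s - \<xi>|\<^sup>2\<close>, \<open>1 + |s|\<^sup>2\<close> and \<open>1 + |\<xi>|\<^sup>2\<close>.
  Lagrange's identity \<open>|s - \<xi>|\<^sup>2 = (1 + |s|\<^sup>2)(1 + |\<xi>|\<^sup>2) - |1 + \<xi> s\<^sup>*|\<^sup>2\<close> and Vandermonde's
  convolution turn it into the stated combination of Berezin kernels.
\<close>

section \<open>Moments of the Fubini-Study measures\<close>

text \<open>
  The uniqueness argument for Haar measure: Fubini and translation invariance identify the two
  measures up to a factor, which is \<open>1\<close> because both give the unit ball the same volume.
\<close>

lemma lborel_distr_orthogonal_transformation:
  fixes T :: "'a::euclidean_space \<Rightarrow> 'a"
  assumes T: "orthogonal_transformation T"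
  shows "distr lborel borel T = lborel"
proof (rule measure_eqI)
  show "sets (distr lborel borel T) = sets lborel" by simp
  have lin: "linear T" using T by (rule orthogonal_transformation_linear)
  have cont: "continuous_on UNIV T"
    using lin by (simp add: linear_continuous_on linear_conv_bounded_linear)
  have [measurable]: "T \<in> borel_measurable borel"
    by (rule borel_measurable_continuous_onI[OF cont])
  fix A assume "A \<in> sets (distr lborel borel T)"
  then have [measurable]: "A \<in> sets borel" by simp
  define f where "f = (indicator (ball 0 1) :: 'a \<Rightarrow> ennreal)"
  define g where "g = (indicator A :: 'a \<Rightarrow> ennreal)"
  define c where "c = (\<integral>\<^sup>+x. f x \<partial>lborel)"
  have [measurable]: "f \<in> borel_measurable borel" "g \<in> borel_measurable borel"
    unfolding f_def g_def by (intro borel_measurable_indicator; simp)+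
  have transl: "(\<integral>\<^sup>+x. h (x + a) \<partial>lborel) = (\<integral>\<^sup>+x. h x \<partial>lborel)"
    if [measurable]: "h \<in> borel_measurable borel" for h :: "'a \<Rightarrow> ennreal" and a
  proof -
    have "(\<integral>\<^sup>+x. h x \<partial>lborel) = (\<integral>\<^sup>+x. h x \<partial>(distr lborel borel ((+) a)))"
      by (simp add: lborel_distr_plus)
    also have "\<dots> = (\<integral>\<^sup>+x. h (a + x) \<partial>lborel)"
      by (subst nn_integral_distr) auto
    finally show ?thesis by (simp add: add.commute)
  qed
  have translT: "(\<integral>\<^sup>+y. h (T y + x) \<partial>lborel) = (\<integral>\<^sup>+y. h (T y) \<partial>lborel)"
    if [measurable]: "h \<in> borel_measurable borel" for h :: "'a \<Rightarrow> ennreal" and x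
  proof -
    obtain v where v: "x = T v"
      using orthogonal_transformation_surj[OF T] by (metis surjD)
    show ?thesis
      using transl[of "\<lambda>y. h (T y)" v] by (simp add: v linear_add[OF lin])
  qed
  \<comment> \<open>The double integral of \<open>f x * g (T y + x)\<close> is evaluated in both
    orders. With \<open>y\<close> innermost, the shift by \<open>x\<close> is absorbed through a
    preimage of \<open>x\<close> under \<open>T\<close>. With \<open>x\<close> innermost, the shift
    by \<open>T y\<close> moves into \<open>f\<close>, whose integral over \<open>y\<close> is again
    \<open>c\<close>, since the ball is symmetric and \<open>T\<close> preserves norms.\<close>
  have "c * (\<integral>\<^sup>+y. g (T y) \<partial>lborel) = (\<integral>\<^sup>+x. f x * (\<integral>\<^sup>+y. g (T y) \<partial>lborel) \<partial>lborel)"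
    by (simp add: c_def nn_integral_multc)
  also have "\<dots> = (\<integral>\<^sup>+x. (\<integral>\<^sup>+y. f x * g (T y + x) \<partial>lborel) \<partial>lborel)"
    by (simp add: nn_integral_cmult translT)
  also have "\<dots> = (\<integral>\<^sup>+y. (\<integral>\<^sup>+x. f x * g (T y + x) \<partial>lborel) \<partial>lborel)"
    by (rule lborel_pair.Fubini') measurable
  also have "\<dots> = (\<integral>\<^sup>+y. (\<integral>\<^sup>+x. f (x - T y) * g x \<partial>lborel) \<partial>lborel)"
  proof (rule nn_integral_cong)
    fix y
    show "(\<integral>\<^sup>+x. f x * g (T y + x) \<partial>lborel) = (\<integral>\<^sup>+x. f (x - T y) * g x \<partial>lborel)"
      using transl[of "\<lambda>x. f (x - T y) * g x" "T y"] by (simp add: add.commute)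
  qed
  also have "\<dots> = (\<integral>\<^sup>+x. (\<integral>\<^sup>+y. f (x - T y) * g x \<partial>lborel) \<partial>lborel)"
    by (rule lborel_pair.Fubini') measurable
  also have "\<dots> = (\<integral>\<^sup>+x. c * g x \<partial>lborel)"
  proof (rule nn_integral_cong)
    fix x
    have "(\<integral>\<^sup>+y. f (x - T y) \<partial>lborel) = (\<integral>\<^sup>+y. f (T y + (- x)) \<partial>lborel)"
      by (rule nn_integral_cong) (auto simp: f_def indicator_def norm_minus_commute)
    also have "\<dots> = c"
      unfolding translT[of f, OF \<open>f \<in> borel_measurable borel\<close>] c_def
      by (rule nn_integral_cong)
         (auto simp: f_def indicator_def orthogonal_transformation_norm[OF T])
    finally show "(\<integral>\<^sup>+y. f (x - T y) * g x \<partial>lborel) = c * g x"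
      by (simp add: nn_integral_multc)
  qed
  also have "\<dots> = c * (\<integral>\<^sup>+x. g x \<partial>lborel)"
    by (rule nn_integral_cmult) measurable
  finally have eq: "c * (\<integral>\<^sup>+y. g (T y) \<partial>lborel) = c * (\<integral>\<^sup>+x. g x \<partial>lborel)" .
  have c: "c = emeasure lborel (ball (0::'a) 1)"
    by (simp add: c_def f_def)
  then have "c = ennreal (unit_ball_vol (real DIM('a)))"
    using emeasure_ball[of 1 "0::'a"] by simp
  moreover have "unit_ball_vol (real DIM('a)) > 0"
    by (rule unit_ball_vol_pos) simp
  ultimately have "c \<noteq> 0" "c \<noteq> top"
    by (auto simp flip: not_le)
  with eq have "(\<integral>\<^sup>+y. g (T y) \<partial>lborel) = (\<integral>\<^sup>+x. g x \<partial>lborel)"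
    by (simp add: ennreal_mult_cancel_left)
  moreover have "(\<integral>\<^sup>+y. g (T y) \<partial>lborel) = emeasure (distr lborel borel T) A"
    by (subst nn_integral_distr[of T _ borel g, symmetric]) (auto simp: g_def)
  ultimately show "emeasure (distr lborel borel T) A = emeasure lborel A"
    by (simp add: g_def)
qed

text \<open>Half-lines generate the Borel sets and are stable under intersection, and for
  \<open>a \<ge> 0\<close> both measures give \<open>{..a}\<close> the area \<open>pi * a\<close> of
  the disc of radius \<open>sqrt a\<close>. This replaces polar coordinates: radial integrals become
  integrals over \<open>{0..}\<close> in the variable |z|^2.\<close>

lemma distr_lborel_cmod_squared:
  "distr lborel borel (\<lambda>z::complex. (cmod z)\<^sup>2) =
     density lborel (\<lambda>x. ennreal pi * indicator {0..} x)"
proof (rule measure_eqI_generator_eq[where E = "range atMost" and \<Omega> = UNIV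
      and A = "\<lambda>n. {..real n}"])
  fix X :: "real set" assume "X \<in> range atMost"
  then obtain a where X: "X = {..a}" by auto
  show "emeasure (distr lborel borel (\<lambda>z::complex. (cmod z)\<^sup>2)) X =
      emeasure (density lborel (\<lambda>x. ennreal pi * indicator {0..} x)) X"
  proof (cases "a < 0")
    case True
    have "(\<lambda>z. (cmod z)\<^sup>2) -` {..a} = {}" "{0..} \<inter> {..a} = {}"
      using True zero_le_power2 by (auto simp: not_le) (meson less_le_trans not_le zero_le_power2)
    then show ?thesis
      by (simp add: X emeasure_distr emeasure_density nn_integral_cmult mult.assoc
          flip: indicator_inter_arith)
  next
    case False
    have "(\<lambda>z. (cmod z)\<^sup>2) -` {..a} = cball 0 (sqrt a)"
      using False by (auto simp: real_le_rsqrt sqrt_ge_absD)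
    moreover have "{0..} \<inter> {..a} = {0..a}" by auto
    ultimately show ?thesis
      using False
      by (simp add: X emeasure_distr emeasure_density nn_integral_cmult mult.assoc emeasure_cball
          unit_ball_vol_2 ennreal_mult flip: indicator_inter_arith)
  qed
next
  show "sets (distr lborel borel (\<lambda>z::complex. (cmod z)\<^sup>2)) = sigma_sets UNIV (range atMost)"
    by (simp add: borel_eq_atMost)
  show "sets (density lborel (\<lambda>x. ennreal pi * indicator {0::real..} x)) = sigma_sets UNIV (range atMost)"
    by (simp add: borel_eq_atMost)
  show "(\<Union>i. {..real i}) = UNIV"
    by (auto simp: real_arch_simple)
  fix i
  have "(\<lambda>z. (cmod z)\<^sup>2) -` {..real i} = cball 0 (sqrt i)"
    by (auto simp: real_le_rsqrt sqrt_ge_absD)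
  then show "emeasure (distr lborel borel (\<lambda>z::complex. (cmod z)\<^sup>2)) {..real i} \<noteq> \<infinity>"
    by (simp add: emeasure_distr emeasure_cball)
qed (auto simp: Int_stable_def)

section \<open>Radial moments as beta integrals on the half-line\<close>

lemma tendsto_inverse_1_plus_at_top: "((\<lambda>x::real. 1 / (1 + x)) \<longlongrightarrow> 0) at_top"
  by (intro tendsto_divide_0[OF tendsto_const] filterlim_at_top_imp_at_infinity
      filterlim_tendsto_add_at_top[OF tendsto_const] filterlim_ident)

lemma tendsto_over_1_plus_at_top: "((\<lambda>x::real. x / (1 + x)) \<longlongrightarrow> 1) at_top"
proof -
  have "((\<lambda>x::real. 1 - 1 / (1 + x)) \<longlongrightarrow> 1 - 0) at_top"
    by (intro tendsto_intros tendsto_inverse_1_plus_at_top)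
  moreover have "\<forall>\<^sub>F x::real in at_top. 1 - 1 / (1 + x) = x / (1 + x)"
    using eventually_gt_at_top[of 0] by eventually_elim (simp add: field_simps)
  ultimately show ?thesis
    by (simp add: filterlim_cong)
qed

text \<open>
  The step from \<open>Suc i\<close> down to \<open>i\<close> integrates the derivative of \<open>x\<^bsup>i + 1\<^esup> / (1 + x)\<^bsup>\<tau> + 1\<^esup>\<close>.
\<close>

lemma power_over_power_antiderivative:
  fixes \<tau> i :: nat
  assumes "i \<le> \<tau>"
  shows "\<exists>F. F 0 = 0 \<and> (\<forall>x\<ge>0. (F has_real_derivative x ^ i / (1 + x) ^ (\<tau> + 2)) (at x)) \<and>
     (F \<longlongrightarrow> 1 / (real (\<tau> + 1) * real (\<tau> choose i))) at_top"
  using assms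
proof (induction i rule: inc_induct)
  case base
  have "((\<lambda>x. (x / (1 + x)) ^ (\<tau> + 1) / real (\<tau> + 1)) has_real_derivative
       x ^ \<tau> / (1 + x) ^ (\<tau> + 2)) (at x)" if "x \<ge> 0" for x
  proof -
    have "1 + x > 0" using that by simp
    then have "((\<lambda>x. x / (1 + x)) has_real_derivative 1 / (1 + x)\<^sup>2) (at x)"
      by (auto intro!: derivative_eq_intros simp: power2_eq_square)
    from DERIV_cdivide[OF DERIV_power[OF this, of "\<tau> + 1"], of "real (\<tau> + 1)"]
    show ?thesis
      using \<open>1 + x > 0\<close> by (simp add: power_divide power_add power2_eq_square mult_ac del: of_nat_Suc)
  qed
  moreover have "((\<lambda>x. (x / (1 + x)) ^ (\<tau> + 1) / real (\<tau> + 1)) \<longlongrightarrow> 1 ^ (\<tau> + 1) / real (\<tau> + 1)) at_top"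
    by (intro tendsto_intros tendsto_over_1_plus_at_top) auto
  ultimately show ?case
    by (intro exI[of _ "\<lambda>x. (x / (1 + x)) ^ (\<tau> + 1) / real (\<tau> + 1)"]) auto
next
  case (step i)
  then obtain G where G: "G 0 = 0"
    "\<And>x. x \<ge> 0 \<Longrightarrow> (G has_real_derivative x ^ Suc i / (1 + x) ^ (\<tau> + 2)) (at x)"
    "(G \<longlongrightarrow> 1 / (real (\<tau> + 1) * real (\<tau> choose Suc i))) at_top" by auto
  define F where "F = (\<lambda>x. (x ^ Suc i / (1 + x) ^ (\<tau> + 1) + real (\<tau> - i) * G x) / real (i + 1))"
  have "(F has_real_derivative x ^ i / (1 + x) ^ (\<tau> + 2)) (at x)" if "x \<ge> 0" for x
  proof -
    have "1 + x > 0" using that by simp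
    have \<tau>: "real \<tau> = real (\<tau> - i) + real i" using step by simp
    have "((\<lambda>x. x ^ Suc i / (1 + x) ^ (\<tau> + 1)) has_real_derivative
        ((real i + 1) * x ^ i * (1 + x) ^ (\<tau> + 1) - x ^ Suc i * ((real \<tau> + 1) * (1 + x) ^ \<tau>))
          / ((1 + x) ^ (\<tau> + 1))\<^sup>2) (at x)"
    proof -
      have d1: "((\<lambda>x. x ^ Suc i) has_real_derivative (real i + 1) * x ^ i) (at x)"
        using DERIV_pow[of "Suc i" x] by (simp add: add.commute)
      have d2: "((\<lambda>x. (1 + x) ^ (\<tau> + 1)) has_real_derivative (real \<tau> + 1) * (1 + x) ^ \<tau>) (at x)"
        using DERIV_power[OF DERIV_add[OF DERIV_const DERIV_ident], where n = "\<tau> + 1", of 1 x UNIV]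
        by (simp add: add.commute)
      show ?thesis
        using DERIV_divide[OF d1 d2] \<open>1 + x > 0\<close>
        by (simp add: power2_eq_square mult_ac)
    qed
    moreover have "((real i + 1) * x ^ i * (1 + x) ^ (\<tau> + 1) - x ^ Suc i * ((real \<tau> + 1) * (1 + x) ^ \<tau>))
          / ((1 + x) ^ (\<tau> + 1))\<^sup>2 = ((real i + 1) * x ^ i - real (\<tau> - i) * x ^ Suc i) / (1 + x) ^ (\<tau> + 2)"
      using \<open>1 + x > 0\<close> by (simp add: \<tau> divide_simps power2_eq_square power_add) (simp add: algebra_simps)
    ultimately have "((\<lambda>x. x ^ Suc i / (1 + x) ^ (\<tau> + 1)) has_real_derivative
        ((real i + 1) * x ^ i - real (\<tau> - i) * x ^ Suc i) / (1 + x) ^ (\<tau> + 2)) (at x)" by simp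
    then have "(F has_real_derivative (((real i + 1) * x ^ i - real (\<tau> - i) * x ^ Suc i) / (1 + x) ^ (\<tau> + 2)
        + real (\<tau> - i) * (x ^ Suc i / (1 + x) ^ (\<tau> + 2))) / real (i + 1)) (at x)"
      unfolding F_def by (intro DERIV_cdivide DERIV_add DERIV_cmult G that)
    also have "(((real i + 1) * x ^ i - real (\<tau> - i) * x ^ Suc i) / (1 + x) ^ (\<tau> + 2)
        + real (\<tau> - i) * (x ^ Suc i / (1 + x) ^ (\<tau> + 2))) / real (i + 1) = x ^ i / (1 + x) ^ (\<tau> + 2)"
      using \<open>1 + x > 0\<close> by (simp add: add_divide_distrib[symmetric] divide_simps)
    finally show ?thesis .
  qed
  moreover have "(F \<longlongrightarrow> 1 / (real (\<tau> + 1) * real (\<tau> choose i))) at_top"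
  proof -
    \<comment> \<open>Since i < \<tau>, the boundary term splits into factors tending to 1 and
      \<open>d + 1 \<ge> 1\<close> factors tending to 0, so it vanishes at infinity.\<close>
    obtain d where d: "\<tau> = i + 1 + d" using step by (metis Suc_eq_plus1 less_imp_Suc_add add_Suc add.commute)
    have "((\<lambda>x::real. (x / (1 + x)) ^ Suc i * (1 / (1 + x)) ^ (d + 1)) \<longlongrightarrow> 1 ^ Suc i * 0 ^ (d + 1)) at_top"
      by (intro tendsto_intros tendsto_over_1_plus_at_top tendsto_inverse_1_plus_at_top)
    moreover have "(x / (1 + x)) ^ Suc i * (1 / (1 + x)) ^ (d + 1) = x ^ Suc i / (1 + x) ^ (\<tau> + 1)" for x :: real
      by (simp add: d power_divide power_add)
    ultimately have "((\<lambda>x::real. x ^ Suc i / (1 + x) ^ (\<tau> + 1)) \<longlongrightarrow> 0) at_top" by simp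
    then have "(F \<longlongrightarrow> (0 + real (\<tau> - i) * (1 / (real (\<tau> + 1) * real (\<tau> choose Suc i)))) / real (i + 1)) at_top"
      unfolding F_def by (intro tendsto_intros G(3)) auto
    moreover have "real (\<tau> - i) * real (\<tau> choose i) = real (\<tau> choose Suc i) * real (i + 1)"
      by (metis (no_types, lifting) Suc_eq_plus1 mult.commute of_nat_mult binomial_absorb_comp binomial_absorption)
    then have "(0 + real (\<tau> - i) * (1 / (real (\<tau> + 1) * real (\<tau> choose Suc i)))) / real (i + 1)
      = 1 / (real (\<tau> + 1) * real (\<tau> choose i))"
      using step by (simp add: divide_simps del: binomial_Suc_Suc of_nat_Suc)
    ultimately show ?thesis by simp
  qed
  moreover have "F 0 = 0" by (simp add: F_def G)
  ultimately show ?case by blast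
qed

text \<open>In the variable x = |z|^2 the density \<open>pi\<close> of the pushforward cancels the
  \<open>pi\<close> in the weight, and the fundamental theorem of calculus evaluates the rest. The
  value is the squared norm of \<open>z ^ i\<close> in \<open>H_\<tau>\<close>.\<close>

lemma nn_integral_iota_w_moment:
  assumes "i \<le> \<tau>"
  shows "(\<integral>\<^sup>+z. ennreal (iota_w \<tau> z * ((cmod z)\<^sup>2) ^ i) \<partial>lborel) = ennreal (1 / real (\<tau> choose i))"
proof -
  define h where "h = (\<lambda>x::real. x ^ i / (1 + x) ^ (\<tau> + 2))"
  have [measurable]: "h \<in> borel_measurable borel" by (simp add: h_def)
  obtain F where F: "F 0 = 0" "\<forall>x\<ge>0. (F has_real_derivative h x) (at x)"
     "(F \<longlongrightarrow> 1 / (real (\<tau> + 1) * real (\<tau> choose i))) at_top"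
    using power_over_power_antiderivative[OF assms] by (auto simp: h_def)
  have "(\<integral>\<^sup>+z. ennreal (iota_w \<tau> z * ((cmod z)\<^sup>2) ^ i) \<partial>lborel) =
      (\<integral>\<^sup>+z. ennreal (real (\<tau> + 1) / pi) * ennreal (h ((cmod z)\<^sup>2)) \<partial>lborel)"
    by (intro nn_integral_cong) (simp add: iota_w_def h_def flip: ennreal_mult')
  also have "\<dots> = ennreal (real (\<tau> + 1) / pi) *
      (\<integral>\<^sup>+x. ennreal (h x) \<partial>distr lborel borel (\<lambda>z::complex. (cmod z)\<^sup>2))"
    by (simp add: nn_integral_cmult nn_integral_distr)
  also have "\<dots> = ennreal (real (\<tau> + 1) / pi) *
      (ennreal pi * (\<integral>\<^sup>+x. ennreal (h x) * indicator {0..} x \<partial>lborel))"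
    unfolding distr_lborel_cmod_squared
    by (simp add: nn_integral_density nn_integral_cmult[symmetric] mult_ac)
  also have "(\<integral>\<^sup>+x. ennreal (h x) * indicator {0..} x \<partial>lborel) =
      ennreal (1 / (real (\<tau> + 1) * real (\<tau> choose i)) - F 0)"
    by (rule nn_integral_FTC_atLeast) (use F in \<open>auto simp: h_def\<close>)
  finally show ?thesis
    using F(1) by (simp add: ennreal_mult'[symmetric] del: of_nat_Suc of_nat_add)
qed

text \<open>A Bochner integral is 0 by convention when the integrand is not integrable. This
  predicate and its two-variable analogue carry integrability together with the value, so that
  integrals of finite sums can be taken term by term.\<close>

definition has_int_iota :: "nat \<Rightarrow> (complex \<Rightarrow> complex) \<Rightarrow> complex \<Rightarrow> bool" where
  "has_int_iota \<tau> g v \<longleftrightarrow>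
     has_bochner_integral lborel (\<lambda>z. complex_of_real (iota_w \<tau> z) * g z) v"

definition has_int_iota2 :: "nat \<Rightarrow> nat \<Rightarrow> (complex \<Rightarrow> complex \<Rightarrow> complex) \<Rightarrow> complex \<Rightarrow> bool" where
  "has_int_iota2 \<mu> \<nu> G v \<longleftrightarrow>
     has_bochner_integral lborel
       (\<lambda>p. complex_of_real (iota_w \<mu> (fst p) * iota_w \<nu> (snd p)) * G (fst p) (snd p)) v"

lemma has_int_iota_imp_eq: "has_int_iota \<tau> g v \<Longrightarrow> int_iota \<tau> g = v"
  by (simp add: has_int_iota_def int_iota_def has_bochner_integral_integral_eq)

lemma has_int_iota2_imp_eq: "has_int_iota2 \<mu> \<nu> G v \<Longrightarrow> int_iota2 \<mu> \<nu> G = v"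
  by (simp add: has_int_iota2_def int_iota2_def has_bochner_integral_integral_eq)

lemma has_int_iota_sum:
  assumes "\<And>a. a \<in> A \<Longrightarrow> has_int_iota \<tau> (g a) (v a)"
  shows "has_int_iota \<tau> (\<lambda>z. \<Sum>a\<in>A. g a z) (\<Sum>a\<in>A. v a)"
  using assms unfolding has_int_iota_def by (auto simp: sum_distrib_left intro!: has_bochner_integral_sum)

lemma has_int_iota2_sum:
  assumes "\<And>a. a \<in> A \<Longrightarrow> has_int_iota2 \<mu> \<nu> (g a) (v a)"
  shows "has_int_iota2 \<mu> \<nu> (\<lambda>z w. \<Sum>a\<in>A. g a z w) (\<Sum>a\<in>A. v a)"
  using assms unfolding has_int_iota2_def by (auto simp: sum_distrib_left intro!: has_bochner_integral_sum)

lemma has_int_iota_cmult: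
  assumes "has_int_iota \<tau> g v"
  shows "has_int_iota \<tau> (\<lambda>z. c * g z) (c * v)"
  using has_bochner_integral_mult_right[OF assms[unfolded has_int_iota_def], of c]
  by (simp add: has_int_iota_def mult_ac)

lemma has_int_iota2_cmult:
  assumes "has_int_iota2 \<mu> \<nu> g v"
  shows "has_int_iota2 \<mu> \<nu> (\<lambda>z w. c * g z w) (c * v)"
  using has_bochner_integral_mult_right[OF assms[unfolded has_int_iota2_def], of c]
  by (simp add: has_int_iota2_def mult_ac)

text \<open>Fubini: the weight on pairs is a product, and \<open>lborel\<close> on pairs is the
  product of the two Lebesgue measures.\<close>

lemma has_int_iota2_prod:
  assumes "has_int_iota \<mu> g u" and "has_int_iota \<nu> h v"
  shows "has_int_iota2 \<mu> \<nu> (\<lambda>z w. g z * h w) (u * v)"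
proof -
  define g' where "g' = (\<lambda>z. complex_of_real (iota_w \<mu> z) * g z)"
  define h' where "h' = (\<lambda>z. complex_of_real (iota_w \<nu> z) * h z)"
  have g: "has_bochner_integral lborel g' u" and h: "has_bochner_integral lborel h' v"
    using assms by (simp_all add: g'_def h'_def has_int_iota_def)
  then have [simp]: "integrable lborel g'" "integrable lborel h'" "integral\<^sup>L lborel g' = u"
      "integral\<^sup>L lborel h' = v"
    by (auto simp: has_bochner_integral_iff)
  have [measurable]: "g' \<in> borel_measurable borel" "h' \<in> borel_measurable borel"
    using borel_measurable_has_bochner_integral[OF g] borel_measurable_has_bochner_integral[OF h]
    by simp_all
  have int: "integrable (lborel \<Otimes>\<^sub>M lborel) (\<lambda>(z, w). g' z * h' w)"
    by (rule lborel_pair.Fubini_integrable) (auto simp: norm_mult)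
  have "integral\<^sup>L (lborel \<Otimes>\<^sub>M lborel) (\<lambda>(z, w). g' z * h' w) = (LINT z|lborel. LINT w|lborel. g' z * h' w)"
    using lborel_pair.integral_fst'[OF int] by simp
  also have "\<dots> = u * v" by simp
  finally have "has_bochner_integral lborel (\<lambda>(z, w). g' z * h' w) (u * v)"
    using int by (simp add: has_bochner_integral_iff lborel_prod)
  then show ?thesis
    by (simp add: has_int_iota2_def g'_def h'_def case_prod_beta' mult_ac)
qed

section \<open>Integrability by growth, and orthogonality of the monomials\<close>

lemma iota_w_nonneg: "iota_w \<tau> z \<ge> 0"
  by (simp add: iota_w_def)

lemma borel_measurable_iota_w [measurable]: "iota_w \<tau> \<in> borel_measurable borel"
  unfolding iota_w_def by measurable

text \<open>Growth of order (1 + |z|^2)^\<tau> is exactly what turns the weight of index \<tau> into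
  a multiple of the weight of index 0, which has finite mass.\<close>

lemma has_int_iota_bounded:
  fixes g :: "complex \<Rightarrow> complex"
  assumes [measurable]: "g \<in> borel_measurable borel"
    and bound: "\<And>z. norm (g z) \<le> K * (1 + (cmod z)\<^sup>2) ^ \<tau>"
  shows "has_int_iota \<tau> g (int_iota \<tau> g)"
proof -
  have "integrable lborel (iota_w 0)"
    using nn_integral_iota_w_moment[of 0 0]
    by (intro integrableI_nonneg) (auto simp: iota_w_nonneg)
  then have "integrable lborel (\<lambda>z. real (\<tau> + 1) * K * iota_w 0 z)"
    by (rule integrable_mult_right)
  then have "integrable lborel (\<lambda>z. complex_of_real (iota_w \<tau> z) * g z)"
  proof (rule Bochner_Integration.integrable_bound)
    show "AE z in lborel. norm (complex_of_real (iota_w \<tau> z) * g z) \<le> norm (real (\<tau> + 1) * K * iota_w 0 z)"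
    proof (rule AE_I2)
      fix z :: complex
      have pos: "1 + (cmod z)\<^sup>2 > 0" by (simp add: add_pos_nonneg)
      have "norm (complex_of_real (iota_w \<tau> z) * g z) \<le> iota_w \<tau> z * (K * (1 + (cmod z)\<^sup>2) ^ \<tau>)"
        using bound[of z] by (simp add: norm_mult iota_w_nonneg mult_left_mono)
      also have "\<dots> = real (\<tau> + 1) * K * iota_w 0 z"
        using pos by (simp add: iota_w_def power_add)
      finally show "norm (complex_of_real (iota_w \<tau> z) * g z) \<le> norm (real (\<tau> + 1) * K * iota_w 0 z)"
        by simp
    qed
  qed measurable
  then show ?thesis
    by (simp add: has_int_iota_def int_iota_def has_bochner_integral_integrable)
qed

text \<open>Each factor is at most max(1, |z|)^\<tau>, and max(1, |z|)^2 is at most 1 +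
  |z|^2.\<close>

lemma cmod_power_le:
  assumes "i \<le> \<tau>" "j \<le> \<tau>"
  shows "cmod z ^ i * cmod z ^ j \<le> (1 + (cmod z)\<^sup>2) ^ \<tau>"
proof -
  define b where "b = max 1 (cmod z)"
  have "cmod z ^ i \<le> b ^ \<tau>" if "i \<le> \<tau>" for i
  proof -
    have "cmod z ^ i \<le> b ^ i" by (intro power_mono) (auto simp: b_def)
    also have "\<dots> \<le> b ^ \<tau>" by (intro power_increasing that) (auto simp: b_def)
    finally show ?thesis .
  qed
  then have "cmod z ^ i * cmod z ^ j \<le> b ^ \<tau> * b ^ \<tau>"
    using assms by (intro mult_mono) (auto simp: b_def)
  also have "\<dots> = (b\<^sup>2) ^ \<tau>" by (simp add: power2_eq_square power_mult_distrib)
  also have "\<dots> \<le> (1 + (cmod z)\<^sup>2) ^ \<tau>"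
    by (intro power_mono) (auto simp: b_def max_def)
  finally show ?thesis .
qed

lemma has_int_iota_bounded_times_monomial:
  fixes f :: "complex \<Rightarrow> complex"
  assumes [measurable]: "f \<in> borel_measurable borel" and bound: "\<And>z. norm (f z) \<le> K"
    and "i \<le> \<tau>" "j \<le> \<tau>"
  shows "has_int_iota \<tau> (\<lambda>z. f z * (z ^ i * cnj z ^ j)) (int_iota \<tau> (\<lambda>z. f z * (z ^ i * cnj z ^ j)))"
proof (rule has_int_iota_bounded)
  have [measurable]: "cnj \<in> borel_measurable borel"
    by (intro borel_measurable_continuous_onI continuous_intros)
  show "(\<lambda>z. f z * (z ^ i * cnj z ^ j)) \<in> borel_measurable borel" by measurable
  fix z
  have "0 \<le> K" using bound[of 0] norm_ge_zero order_trans by blast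
  then show "norm (f z * (z ^ i * cnj z ^ j)) \<le> K * (1 + (cmod z)\<^sup>2) ^ \<tau>"
    using bound[of z] cmod_power_le[OF assms(3,4), of z]
    by (auto simp: norm_mult norm_power intro!: mult_mono)
qed

text \<open>Rotation invariance of Lebesgue measure and of the weight kills the mixed moments; the
  diagonal ones are the radial moments. So the monomials are orthogonal, with inverse binomial
  coefficients as squared norms.\<close>

lemma has_int_iota_monomial:
  assumes "i \<le> \<tau>" "j \<le> \<tau>"
  shows "has_int_iota \<tau> (\<lambda>z. z ^ i * cnj z ^ j) (if i = j then 1 / of_nat (\<tau> choose i) else 0)"
proof -
  define I where "I = int_iota \<tau> (\<lambda>z. z ^ i * cnj z ^ j)"
  have has: "has_int_iota \<tau> (\<lambda>z. z ^ i * cnj z ^ j) I"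
    using has_int_iota_bounded_times_monomial[of "\<lambda>_. 1" 1, OF _ _ assms] by (simp add: I_def)
  have "I = 1 / of_nat (\<tau> choose i)" if "i = j"
  proof -
    have eq: "z ^ j * cnj z ^ j = complex_of_real (((cmod z)\<^sup>2) ^ j)" for z
      by (metis complex_norm_square of_real_power power_mult_distrib)
    have "I = (LINT z|lborel. complex_of_real (iota_w \<tau> z * ((cmod z)\<^sup>2) ^ i))"
      unfolding I_def int_iota_def that of_real_mult eq ..
    also have "\<dots> = complex_of_real (LINT z|lborel. iota_w \<tau> z * ((cmod z)\<^sup>2) ^ i)"
      by (rule integral_complex_of_real)
    also have "(LINT z|lborel. iota_w \<tau> z * ((cmod z)\<^sup>2) ^ i) = 1 / real (\<tau> choose i)"
      using nn_integral_iota_w_moment[OF assms(1)]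
      by (subst integral_eq_nn_integral) (auto simp: iota_w_nonneg)
    finally show ?thesis by simp
  qed
  moreover have "I = 0" if "i \<noteq> j"
  proof -
    \<comment> \<open>Rotating by \<open>c\<close> multiplies the integrand by \<open>c ^ i * cnj c ^ j = - 1\<close>.\<close>
    define c where "c = cis (pi / (real i - real j))"
    have "c ^ i * cnj c ^ j = cis (real i * (pi / (real i - real j)) + real j * (- (pi / (real i - real j))))"
      unfolding c_def cis_cnj Complex.DeMoivre cis_mult ..
    also have "real i * (pi / (real i - real j)) + real j * (- (pi / (real i - real j))) =
        (real i - real j) * (pi / (real i - real j))"
      by (metis diff_conv_add_uminus left_diff_distrib mult_minus_right)
    also have "\<dots> = pi" using that by simp
    finally have c: "c ^ i * cnj c ^ j = - 1" by simp
    have norm_c: "cmod c = 1" by (simp add: c_def)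
    have "orthogonal_transformation ((*) c)"
      using norm_c by (auto simp: orthogonal_transformation norm_mult intro!: bounded_linear.linear bounded_linear_mult_right)
    then have inv: "distr lborel borel ((*) c) = lborel"
      by (rule lborel_distr_orthogonal_transformation)
    have [measurable]: "cnj \<in> borel_measurable borel"
      by (intro borel_measurable_continuous_onI continuous_intros)
    have "I = (LINT z|distr lborel borel ((*) c). complex_of_real (iota_w \<tau> z) * (z ^ i * cnj z ^ j))"
      by (simp add: inv I_def int_iota_def)
    also have "\<dots> = (LINT z|lborel. complex_of_real (iota_w \<tau> (c * z)) * ((c * z) ^ i * cnj (c * z) ^ j))"
      by (rule integral_distr) measurable
    also have "\<dots> = (LINT z|lborel. (c ^ i * cnj c ^ j) * (complex_of_real (iota_w \<tau> z) * (z ^ i * cnj z ^ j)))"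
      by (simp add: iota_w_def norm_mult norm_c power_mult_distrib mult_ac)
    also have "\<dots> = - I"
      unfolding c by (simp add: I_def int_iota_def)
    finally show ?thesis by simp
  qed
  ultimately show ?thesis using has by auto
qed

section \<open>Inner products in terms of coefficients\<close>

lemma inner_H_coeffs:
  assumes "\<And>z. p z = (\<Sum>i\<le>\<tau>. c i * z ^ i)" "\<And>z. q z = (\<Sum>i\<le>\<tau>. d i * z ^ i)"
  shows "inner_H \<tau> p q = (\<Sum>i\<le>\<tau>. c i * cnj (d i) / of_nat (\<tau> choose i))"
proof -
  have "(\<lambda>z. p z * cnj (q z)) = (\<lambda>z. \<Sum>i\<le>\<tau>. \<Sum>j\<le>\<tau>. (c i * cnj (d j)) * (z ^ i * cnj z ^ j))"
    by (rule ext) (simp add: assms sum_product mult_ac)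
  moreover have "has_int_iota \<tau> \<dots> (\<Sum>i\<le>\<tau>. \<Sum>j\<le>\<tau>. (c i * cnj (d j)) * (if i = j then 1 / of_nat (\<tau> choose i) else 0))"
    by (intro has_int_iota_sum has_int_iota_cmult has_int_iota_monomial) auto
  ultimately have "inner_H \<tau> p q = (\<Sum>i\<le>\<tau>. \<Sum>j\<le>\<tau>. (c i * cnj (d j)) * (if i = j then 1 / of_nat (\<tau> choose i) else 0))"
    unfolding inner_H_def by (simp add: has_int_iota_imp_eq)
  also have "\<dots> = (\<Sum>i\<le>\<tau>. \<Sum>j\<le>\<tau>. if i = j then c i * cnj (d j) / of_nat (\<tau> choose i) else 0)"
    by (intro sum.cong) auto
  finally show ?thesis by simp
qed

lemma inner_T_coeffs:
  assumes "\<And>z w. F z w = (\<Sum>i\<le>\<mu>. \<Sum>j\<le>\<nu>. c i j * z ^ i * w ^ j)"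
    and "\<And>z w. G z w = (\<Sum>i\<le>\<mu>. \<Sum>j\<le>\<nu>. d i j * z ^ i * w ^ j)"
  shows "inner_T \<mu> \<nu> F G =
    (\<Sum>i\<le>\<mu>. \<Sum>j\<le>\<nu>. c i j * cnj (d i j) / (of_nat (\<mu> choose i) * of_nat (\<nu> choose j)))"
proof -
  let ?m = "\<lambda>i a j b. (if i = a then 1 / of_nat (\<mu> choose i) else 0) * (if j = b then 1 / of_nat (\<nu> choose j) else 0)"
  have "F z w * cnj (G z w) = (\<Sum>i\<le>\<mu>. \<Sum>a\<le>\<mu>. \<Sum>j\<le>\<nu>. \<Sum>b\<le>\<nu>.
      (c i j * cnj (d a b)) * ((z ^ i * cnj z ^ a) * (w ^ j * cnj w ^ b)))" for z w
    by (simp add: assms sum_product mult_ac)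
  then have "(\<lambda>z w. F z w * cnj (G z w)) = (\<lambda>z w. \<Sum>i\<le>\<mu>. \<Sum>a\<le>\<mu>. \<Sum>j\<le>\<nu>. \<Sum>b\<le>\<nu>.
      (c i j * cnj (d a b)) * ((z ^ i * cnj z ^ a) * (w ^ j * cnj w ^ b)))" by blast
  moreover have "has_int_iota2 \<mu> \<nu> \<dots> (\<Sum>i\<le>\<mu>. \<Sum>a\<le>\<mu>. \<Sum>j\<le>\<nu>. \<Sum>b\<le>\<nu>. (c i j * cnj (d a b)) * ?m i a j b)"
    by (intro has_int_iota2_sum has_int_iota2_cmult has_int_iota2_prod has_int_iota_monomial) auto
  ultimately have "inner_T \<mu> \<nu> F G = (\<Sum>i\<le>\<mu>. \<Sum>a\<le>\<mu>. \<Sum>j\<le>\<nu>. \<Sum>b\<le>\<nu>. (c i j * cnj (d a b)) * ?m i a j b)"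
    unfolding inner_T_def by (simp add: has_int_iota2_imp_eq)
  \<comment> \<open>Nesting the two Kronecker deltas lets the sums over \<open>b\<close> and then
    over \<open>a\<close> collapse one after the other.\<close>
  also have "\<dots> = (\<Sum>i\<le>\<mu>. \<Sum>a\<le>\<mu>. if i = a then (\<Sum>j\<le>\<nu>. \<Sum>b\<le>\<nu>. if j = b then
      c i j * cnj (d a b) / (of_nat (\<mu> choose i) * of_nat (\<nu> choose j)) else 0) else 0)"
  proof (intro sum.cong refl)
    fix i a
    show "(\<Sum>j\<le>\<nu>. \<Sum>b\<le>\<nu>. (c i j * cnj (d a b)) * ?m i a j b) =
      (if i = a then (\<Sum>j\<le>\<nu>. \<Sum>b\<le>\<nu>. if j = b then
        c i j * cnj (d a b) / (of_nat (\<mu> choose i) * of_nat (\<nu> choose j)) else 0) else 0)"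
    proof (cases "i = a")
      case True
      show ?thesis
        unfolding if_P[OF True] by (intro sum.cong refl) simp
    qed simp
  qed
  finally show ?thesis by simp
qed

section \<open>Polynomial spaces and their adjoints\<close>

lemma polysI: "(\<And>z. p z = (\<Sum>i\<le>\<tau>. c i * z ^ i)) \<Longrightarrow> p \<in> polys \<tau>"
  by (auto simp: polys_def)

lemma polysE:
  assumes "p \<in> polys \<tau>"
  obtains c where "\<And>z. p z = (\<Sum>i\<le>\<tau>. c i * z ^ i)"
  using assms by (auto simp: polys_def)

lemma tpolysI: "(\<And>z w. F z w = (\<Sum>i\<le>\<mu>. \<Sum>j\<le>\<nu>. c i j * z ^ i * w ^ j)) \<Longrightarrow> F \<in> tpolys \<mu> \<nu>"
  by (auto simp: tpolys_def)

lemma tpolysE: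
  assumes "F \<in> tpolys \<mu> \<nu>"
  obtains c where "\<And>z w. F z w = (\<Sum>i\<le>\<mu>. \<Sum>j\<le>\<nu>. c i j * z ^ i * w ^ j)"
  using assms by (auto simp: tpolys_def)

lemma polys_monom: "i \<le> \<tau> \<Longrightarrow> (\<lambda>z. z ^ i) \<in> polys \<tau>"
  unfolding polys_def
  by (intro CollectI exI[of _ "\<lambda>j. if j = i then 1 else 0"]) (simp add: if_distrib[of "\<lambda>x. x * _"] cong: if_cong)

lemma polys_cmult:
  assumes "p \<in> polys \<tau>" shows "(\<lambda>z. a * p z) \<in> polys \<tau>"
proof -
  obtain c where "\<And>z. p z = (\<Sum>i\<le>\<tau>. c i * z ^ i)" using polysE[OF assms] by blast
  then show ?thesis
    unfolding polys_def
    by (intro CollectI exI[of _ "\<lambda>i. a * c i"]) (simp add: sum_distrib_left mult_ac)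
qed

lemma polys_sum:
  assumes "\<And>t. t \<in> I \<Longrightarrow> p t \<in> polys \<tau>" shows "(\<lambda>z. \<Sum>t\<in>I. p t z) \<in> polys \<tau>"
proof -
  have "\<forall>t\<in>I. \<exists>c. \<forall>z. p t z = (\<Sum>i\<le>\<tau>. c i * z ^ i)" using assms by (auto simp: polys_def)
  from bchoice[OF this] obtain c where c: "\<And>t z. t \<in> I \<Longrightarrow> p t z = (\<Sum>i\<le>\<tau>. c t i * z ^ i)" by blast
  have "(\<Sum>t\<in>I. p t z) = (\<Sum>i\<le>\<tau>. (\<Sum>t\<in>I. c t i) * z ^ i)" for z
    unfolding sum_distrib_right by (subst sum.swap) (simp add: c)
  then show ?thesis by (rule polysI)
qed

lemma tpolys_monom:
  assumes "i \<le> \<mu>" "j \<le> \<nu>" shows "(\<lambda>z w. z ^ i * w ^ j) \<in> tpolys \<mu> \<nu>"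
proof -
  have "z ^ i * w ^ j = (\<Sum>a\<le>\<mu>. \<Sum>b\<le>\<nu>. (if a = i then if b = j then 1 else 0 else 0) * z ^ a * w ^ b)"
    for z w :: complex
  proof -
    have "(\<Sum>a\<le>\<mu>. \<Sum>b\<le>\<nu>. (if a = i then if b = j then 1 else 0 else 0) * z ^ a * w ^ b)
       = (\<Sum>a\<le>\<mu>. if a = i then (\<Sum>b\<le>\<nu>. if b = j then z ^ a * w ^ b else 0) else 0)"
      by (intro sum.cong refl) (auto intro!: sum.neutral simp: if_distrib[of "\<lambda>x. x * _"] cong: if_cong)
    then show ?thesis using assms by simp
  qed
  then show ?thesis by (rule tpolysI)
qed

lemma tpolys_cmult:
  assumes "F \<in> tpolys \<mu> \<nu>" shows "(\<lambda>z w. a * F z w) \<in> tpolys \<mu> \<nu>"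
proof -
  obtain c where "\<And>z w. F z w = (\<Sum>i\<le>\<mu>. \<Sum>j\<le>\<nu>. c i j * z ^ i * w ^ j)"
    using tpolysE[OF assms] by blast
  then show ?thesis
    unfolding tpolys_def
    by (intro CollectI exI[of _ "\<lambda>i j. a * c i j"]) (simp add: sum_distrib_left mult_ac)
qed

lemma tpolys_sum:
  assumes "\<And>t. t \<in> I \<Longrightarrow> F t \<in> tpolys \<mu> \<nu>" shows "(\<lambda>z w. \<Sum>t\<in>I. F t z w) \<in> tpolys \<mu> \<nu>"
proof -
  have "\<forall>t\<in>I. \<exists>c. \<forall>z w. F t z w = (\<Sum>i\<le>\<mu>. \<Sum>j\<le>\<nu>. c i j * z ^ i * w ^ j)"
    using assms by (auto simp: tpolys_def)
  from bchoice[OF this] obtain c where c: "\<And>t z w. t \<in> I \<Longrightarrow> F t z w = (\<Sum>i\<le>\<mu>. \<Sum>j\<le>\<nu>. c t i j * z ^ i * w ^ j)"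
    by blast
  have "(\<Sum>t\<in>I. F t z w) = (\<Sum>i\<le>\<mu>. \<Sum>j\<le>\<nu>. (\<Sum>t\<in>I. c t i j) * z ^ i * w ^ j)" for z w
  proof -
    have "(\<Sum>t\<in>I. F t z w) = (\<Sum>i\<le>\<mu>. \<Sum>t\<in>I. \<Sum>j\<le>\<nu>. c t i j * z ^ i * w ^ j)"
      by (subst sum.swap) (simp add: c)
    also have "\<dots> = (\<Sum>i\<le>\<mu>. \<Sum>j\<le>\<nu>. \<Sum>t\<in>I. c t i j * z ^ i * w ^ j)"
      by (intro sum.cong refl sum.swap)
    finally show ?thesis by (simp add: sum_distrib_right)
  qed
  then show ?thesis by (rule tpolysI)
qed

lemma inner_T_cmult_right: "inner_T \<mu> \<nu> F (\<lambda>z w. a * G z w) = cnj a * inner_T \<mu> \<nu> F G"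
proof -
  have "inner_T \<mu> \<nu> F (\<lambda>z w. a * G z w) = (LINT p|lborel. cnj a *
      (complex_of_real (iota_w \<mu> (fst p) * iota_w \<nu> (snd p)) * (F (fst p) (snd p) * cnj (G (fst p) (snd p)))))"
    unfolding inner_T_def int_iota2_def by (simp add: mult_ac)
  then show ?thesis by (simp add: inner_T_def int_iota2_def)
qed

text \<open>In coefficients, additivity is a rearrangement of finite sums; integrability is already
  contained in \<open>inner_T_coeffs\<close>.\<close>

lemma inner_T_sum_right:
  assumes F: "F \<in> tpolys \<mu> \<nu>" and G: "\<And>t. t \<in> I \<Longrightarrow> G t \<in> tpolys \<mu> \<nu>"
  shows "inner_T \<mu> \<nu> F (\<lambda>z w. \<Sum>t\<in>I. G t z w) = (\<Sum>t\<in>I. inner_T \<mu> \<nu> F (G t))"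
proof -
  obtain c where c: "\<And>z w. F z w = (\<Sum>i\<le>\<mu>. \<Sum>j\<le>\<nu>. c i j * z ^ i * w ^ j)"
    using tpolysE[OF F] by blast
  have "\<forall>t\<in>I. \<exists>d. \<forall>z w. G t z w = (\<Sum>i\<le>\<mu>. \<Sum>j\<le>\<nu>. d i j * z ^ i * w ^ j)"
    using G by (auto simp: tpolys_def)
  from bchoice[OF this] obtain d where d: "\<And>t z w. t \<in> I \<Longrightarrow> G t z w = (\<Sum>i\<le>\<mu>. \<Sum>j\<le>\<nu>. d t i j * z ^ i * w ^ j)"
    by blast
  have *: "(\<Sum>t\<in>I. G t z w) = (\<Sum>i\<le>\<mu>. \<Sum>j\<le>\<nu>. (\<Sum>t\<in>I. d t i j) * z ^ i * w ^ j)" for z w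
  proof -
    have "(\<Sum>t\<in>I. G t z w) = (\<Sum>i\<le>\<mu>. \<Sum>t\<in>I. \<Sum>j\<le>\<nu>. d t i j * z ^ i * w ^ j)"
      by (subst sum.swap) (simp add: d)
    also have "\<dots> = (\<Sum>i\<le>\<mu>. \<Sum>j\<le>\<nu>. \<Sum>t\<in>I. d t i j * z ^ i * w ^ j)"
      by (intro sum.cong refl sum.swap)
    finally show ?thesis by (simp add: sum_distrib_right)
  qed
  have "(\<Sum>t\<in>I. inner_T \<mu> \<nu> F (G t)) = (\<Sum>t\<in>I. \<Sum>i\<le>\<mu>. \<Sum>j\<le>\<nu>.
      c i j * cnj (d t i j) / (of_nat (\<mu> choose i) * of_nat (\<nu> choose j)))"
    by (intro sum.cong refl inner_T_coeffs c d)
  also have "\<dots> = (\<Sum>i\<le>\<mu>. \<Sum>t\<in>I. \<Sum>j\<le>\<nu>.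
      c i j * cnj (d t i j) / (of_nat (\<mu> choose i) * of_nat (\<nu> choose j)))"
    by (rule sum.swap)
  also have "\<dots> = (\<Sum>i\<le>\<mu>. \<Sum>j\<le>\<nu>. \<Sum>t\<in>I.
      c i j * cnj (d t i j) / (of_nat (\<mu> choose i) * of_nat (\<nu> choose j)))"
    by (intro sum.cong refl sum.swap)
  also have "\<dots> = inner_T \<mu> \<nu> F (\<lambda>z w. \<Sum>t\<in>I. G t z w)"
    by (subst inner_T_coeffs[OF c *]) (simp add: sum_divide_distrib sum_distrib_left)
  finally show ?thesis by simp
qed

text \<open>Pairing with a monomial isolates one coefficient, up to a nonzero weight. This gives the
  uniqueness required by the definite description in \<open>P_adj\<close>.\<close>

lemma tpolys_inner_T_eqI:
  assumes "G \<in> tpolys \<mu> \<nu>" "G' \<in> tpolys \<mu> \<nu>"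
    and eq: "\<And>F. F \<in> tpolys \<mu> \<nu> \<Longrightarrow> inner_T \<mu> \<nu> F G = inner_T \<mu> \<nu> F G'"
  shows "G = G'"
proof -
  obtain c where c: "\<And>z w. G z w = (\<Sum>i\<le>\<mu>. \<Sum>j\<le>\<nu>. c i j * z ^ i * w ^ j)"
    using tpolysE[OF assms(1)] by blast
  obtain d where d: "\<And>z w. G' z w = (\<Sum>i\<le>\<mu>. \<Sum>j\<le>\<nu>. d i j * z ^ i * w ^ j)"
    using tpolysE[OF assms(2)] by blast
  have "c i j = d i j" if ij: "i \<le> \<mu>" "j \<le> \<nu>" for i j
  proof -
    \<comment> \<open>The coefficient array of the test monomial
      \<open>z ^ i * w ^ j\<close>.\<close>
    let ?e = "\<lambda>a b. if a = i then if b = j then 1 else 0 else (0::complex)"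
    let ?F = "\<lambda>z w. \<Sum>a\<le>\<mu>. \<Sum>b\<le>\<nu>. ?e a b * z ^ a * w ^ b"
    have *: "(\<Sum>a\<le>\<mu>. \<Sum>b\<le>\<nu>. ?e a b * cnj (c a b) / (of_nat (\<mu> choose a) * of_nat (\<nu> choose b)))
        = cnj (c i j) / (of_nat (\<mu> choose i) * of_nat (\<nu> choose j))" for c :: "nat \<Rightarrow> nat \<Rightarrow> complex"
    proof -
      have "(\<Sum>a\<le>\<mu>. \<Sum>b\<le>\<nu>. ?e a b * cnj (c a b) / (of_nat (\<mu> choose a) * of_nat (\<nu> choose b)))
        = (\<Sum>a\<le>\<mu>. if a = i then (\<Sum>b\<le>\<nu>. if b = j then
            cnj (c a b) / (of_nat (\<mu> choose a) * of_nat (\<nu> choose b)) else 0) else 0)"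
        by (intro sum.cong refl) (auto intro!: sum.neutral simp: if_distrib[of "\<lambda>x. x * _"]
            if_distrib[of "\<lambda>x. x / _"] cong: if_cong)
      then show ?thesis using ij by simp
    qed
    have "?F \<in> tpolys \<mu> \<nu>" by (rule tpolysI) (rule refl)
    from eq[OF this] have "cnj (c i j) / (of_nat (\<mu> choose i) * of_nat (\<nu> choose j))
        = cnj (d i j) / (of_nat (\<mu> choose i) * of_nat (\<nu> choose j))"
      unfolding inner_T_coeffs[OF refl c] inner_T_coeffs[OF refl d] * .
    then show ?thesis using ij by simp
  qed
  then show ?thesis
    by (intro ext) (auto simp: c d intro!: sum.cong)
qed

section \<open>Reproducing kernels and operators with symbol \<open>f\<close>\<close>

lemma kern_expand: "kern \<tau> y x = (\<Sum>i\<le>\<tau>. (of_nat (\<tau> choose i) * cnj y ^ i) * x ^ i)"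
  using binomial_ring[of "x * cnj y" 1 \<tau>] by (simp add: kern_def add.commute power_mult_distrib mult_ac)

text \<open>The binomial coefficients of the kernel cancel the inverse binomial weights of the inner
  product, which leaves evaluation at \<open>y\<close>.\<close>

lemma inner_H_kern:
  assumes "p \<in> polys \<tau>"
  shows "inner_H \<tau> p (kern \<tau> y) = p y"
proof -
  obtain c where c: "\<And>z. p z = (\<Sum>i\<le>\<tau>. c i * z ^ i)" using polysE[OF assms] by blast
  show ?thesis
    unfolding inner_H_coeffs[OF c kern_expand] c by (intro sum.cong) auto
qed

text \<open>The limit at infinity bounds \<open>f\<close> outside a disc, compactness bounds it
  inside.\<close>

lemma C_CP1_bounded:
  assumes "f \<in> C_CP1"
  obtains K where "\<And>z. norm (f z) \<le> K"
proof -
  obtain L where cont: "continuous_on UNIV f" and lim: "(f \<longlongrightarrow> L) at_infinity"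
    using assms by (auto simp: C_CP1_def)
  have "\<forall>\<^sub>F z in at_infinity. dist (f z) L < 1" using lim by (rule tendstoD) simp
  then obtain b where b: "\<And>z. b \<le> norm z \<Longrightarrow> dist (f z) L < 1" by (auto simp: eventually_at_infinity)
  have "compact (f ` cball 0 b)"
    using cont by (intro compact_continuous_image) (auto intro: continuous_on_subset)
  then obtain B where B: "\<And>z. norm z \<le> b \<Longrightarrow> norm (f z) \<le> B"
    by (meson bounded_iff compact_imp_bounded imageI mem_cball_0)
  have "norm (f z) \<le> max B (norm L + 1)" for z
  proof (cases "norm z \<le> b")
    case False
    then have "dist (f z) L < 1" using b by simp
    then have "norm (f z) \<le> norm L + 1"
      using norm_triangle_sub[of "f z" L] by (simp add: dist_norm)
    then show ?thesis by simp
  qed (use B in \<open>auto simp: le_max_iff_disj\<close>)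
  then show ?thesis using that by blast
qed

lemma C_CP1_borel_measurable: "f \<in> C_CP1 \<Longrightarrow> f \<in> borel_measurable borel"
  by (auto simp: C_CP1_def intro: borel_measurable_continuous_onI)

text \<open>Up to the factor \<open>1 / (\<mu> + 1)\<close>, \<open>Rstar \<mu> f\<close> is the
  Toeplitz operator with symbol \<open>f\<close>: multiplication by \<open>f\<close> followed by
  projection onto polynomials. Paired with a polynomial, the projection disappears, leaving an
  integral of \<open>f\<close> in the first variable and the inner product of \<open>H_\<nu>\<close>
  in the second.\<close>

lemma inner_T_tensorI_Rstar:
  assumes f: "f \<in> C_CP1" and F: "F \<in> tpolys \<mu> \<nu>" and G: "G \<in> tpolys \<mu> \<nu>"
  shows "inner_T \<mu> \<nu> (tensorI (Rstar \<mu> f) F) G =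
    1 / of_nat (\<mu> + 1) * int_iota \<mu> (\<lambda>s. f s * inner_H \<nu> (F s) (G s))"
proof -
  obtain c where c: "\<And>z w. F z w = (\<Sum>i\<le>\<mu>. \<Sum>j\<le>\<nu>. c i j * z ^ i * w ^ j)"
    using tpolysE[OF F] by blast
  obtain d where d: "\<And>z w. G z w = (\<Sum>i\<le>\<mu>. \<Sum>j\<le>\<nu>. d i j * z ^ i * w ^ j)"
    using tpolysE[OF G] by blast
  obtain K where K: "\<And>z. norm (f z) \<le> K" using C_CP1_bounded[OF f] by blast
  \<comment> \<open>Both sides turn out to be the same finite combination of these moments of
    \<open>f\<close>.\<close>
  define m where "m i a = int_iota \<mu> (\<lambda>s. f s * (s ^ i * cnj s ^ a))" for i a
  have m: "has_int_iota \<mu> (\<lambda>s. f s * (s ^ i * cnj s ^ a)) (m i a)" if "i \<le> \<mu>" "a \<le> \<mu>" for i a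
    unfolding m_def using C_CP1_borel_measurable[OF f] K that
    by (rule has_int_iota_bounded_times_monomial)
  \<comment> \<open>The coefficients of the image of \<open>F\<close>. The factor
    \<open>\<mu> choose a\<close> comes from expanding the kernel and cancels against the weight of
    the inner product.\<close>
  define e where "e a j = (\<Sum>i\<le>\<mu>. of_nat (\<mu> choose a) / of_nat (\<mu> + 1) * c i j * m i a)" for a j
  have e: "tensorI (Rstar \<mu> f) F z w = (\<Sum>a\<le>\<mu>. \<Sum>j\<le>\<nu>. e a j * z ^ a * w ^ j)" for z w
  proof -
    have "(\<lambda>s. f s * F s w * (1 + z * cnj s) ^ \<mu>) =
       (\<lambda>s. \<Sum>a\<le>\<mu>. \<Sum>i\<le>\<mu>. \<Sum>j\<le>\<nu>. (c i j * w ^ j * of_nat (\<mu> choose a) * z ^ a) * (f s * (s ^ i * cnj s ^ a)))"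
    proof
      fix s
      have "f s * F s w * (1 + z * cnj s) ^ \<mu> = (\<Sum>a\<le>\<mu>. of_nat (\<mu> choose a) * cnj s ^ a * z ^ a) * (f s * F s w)"
        using kern_expand[of \<mu> s z] by (simp add: kern_def)
      also have "\<dots> = (\<Sum>a\<le>\<mu>. \<Sum>i\<le>\<mu>. \<Sum>j\<le>\<nu>. (c i j * w ^ j * of_nat (\<mu> choose a) * z ^ a) * (f s * (s ^ i * cnj s ^ a)))"
        unfolding sum_distrib_right by (intro sum.cong refl) (simp add: c sum_distrib_left mult_ac)
      finally show "f s * F s w * (1 + z * cnj s) ^ \<mu> = \<dots>" .
    qed
    moreover have "has_int_iota \<mu> \<dots> (\<Sum>a\<le>\<mu>. \<Sum>i\<le>\<mu>. \<Sum>j\<le>\<nu>. (c i j * w ^ j * of_nat (\<mu> choose a) * z ^ a) * m i a)"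
      by (intro has_int_iota_sum has_int_iota_cmult m) auto
    ultimately have "tensorI (Rstar \<mu> f) F z w =
        1 / of_nat (\<mu> + 1) * (\<Sum>a\<le>\<mu>. \<Sum>i\<le>\<mu>. \<Sum>j\<le>\<nu>. (c i j * w ^ j * of_nat (\<mu> choose a) * z ^ a) * m i a)"
      unfolding tensorI_def Rstar_def by (simp add: has_int_iota_imp_eq)
    also have "\<dots> = 1 / of_nat (\<mu> + 1) * (\<Sum>a\<le>\<mu>. \<Sum>j\<le>\<nu>. \<Sum>i\<le>\<mu>. (c i j * w ^ j * of_nat (\<mu> choose a) * z ^ a) * m i a)"
      by (intro arg_cong2[of _ _ _ _ "(*)"] sum.cong refl sum.swap)
    also have "\<dots> = (\<Sum>a\<le>\<mu>. \<Sum>j\<le>\<nu>. e a j * z ^ a * w ^ j)"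
      unfolding sum_distrib_left by (intro sum.cong refl) (simp add: e_def sum_distrib_left sum_distrib_right mult_ac)
    finally show ?thesis .
  qed
  have "inner_H \<nu> (F s) (G s) = (\<Sum>j\<le>\<nu>. (\<Sum>i\<le>\<mu>. c i j * s ^ i) * cnj (\<Sum>a\<le>\<mu>. d a j * s ^ a) / of_nat (\<nu> choose j))" for s
  proof (rule inner_H_coeffs)
    fix z
    show "F s z = (\<Sum>j\<le>\<nu>. (\<Sum>i\<le>\<mu>. c i j * s ^ i) * z ^ j)"
      unfolding c sum_distrib_right by (rule sum.swap)
    show "G s z = (\<Sum>j\<le>\<nu>. (\<Sum>i\<le>\<mu>. d i j * s ^ i) * z ^ j)"
      unfolding d sum_distrib_right by (rule sum.swap)
  qed
  note inner = this
  have "(\<lambda>s. f s * inner_H \<nu> (F s) (G s)) =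
      (\<lambda>s. \<Sum>j\<le>\<nu>. \<Sum>i\<le>\<mu>. \<Sum>a\<le>\<mu>. (c i j * cnj (d a j) / of_nat (\<nu> choose j)) * (f s * (s ^ i * cnj s ^ a)))"
    unfolding inner cnj_sum sum_product
    unfolding sum_divide_distrib sum_distrib_left
    by (intro ext sum.cong refl) simp
  moreover have "has_int_iota \<mu> \<dots> (\<Sum>j\<le>\<nu>. \<Sum>i\<le>\<mu>. \<Sum>a\<le>\<mu>. (c i j * cnj (d a j) / of_nat (\<nu> choose j)) * m i a)"
    by (intro has_int_iota_sum has_int_iota_cmult m) auto
  ultimately have rhs: "int_iota \<mu> (\<lambda>s. f s * inner_H \<nu> (F s) (G s)) =
      (\<Sum>j\<le>\<nu>. \<Sum>i\<le>\<mu>. \<Sum>a\<le>\<mu>. (c i j * cnj (d a j) / of_nat (\<nu> choose j)) * m i a)"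
    by (simp add: has_int_iota_imp_eq)
  have "inner_T \<mu> \<nu> (tensorI (Rstar \<mu> f) F) G =
      (\<Sum>a\<le>\<mu>. \<Sum>j\<le>\<nu>. e a j * cnj (d a j) / (of_nat (\<mu> choose a) * of_nat (\<nu> choose j)))"
    by (rule inner_T_coeffs[OF e d])
  also have "\<dots> = (\<Sum>j\<le>\<nu>. \<Sum>a\<le>\<mu>. e a j * cnj (d a j) / (of_nat (\<mu> choose a) * of_nat (\<nu> choose j)))"
    by (rule sum.swap)
  also have "\<dots> = (\<Sum>j\<le>\<nu>. \<Sum>a\<le>\<mu>. \<Sum>i\<le>\<mu>. 1 / of_nat (\<mu> + 1) * ((c i j * cnj (d a j) / of_nat (\<nu> choose j)) * m i a))"
    unfolding e_def sum_distrib_right sum_divide_distrib by (intro sum.cong refl) simp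
  also have "\<dots> = (\<Sum>j\<le>\<nu>. \<Sum>i\<le>\<mu>. \<Sum>a\<le>\<mu>. 1 / of_nat (\<mu> + 1) * ((c i j * cnj (d a j) / of_nat (\<nu> choose j)) * m i a))"
    by (intro sum.cong refl sum.swap)
  finally show ?thesis
    by (simp only: rhs sum_distrib_left)
qed

section \<open>The norm of a product of powers of two linear forms\<close>

text \<open>The homogeneous form matters: one coefficient sequence serves all pairs (x, y). At (1,
  w) it gives the coefficients of a polynomial in \<open>w\<close>; at another pair it evaluates a
  pairing in closed form.\<close>

lemma linear_form_power_product_expand:
  fixes a b c d :: complex
  shows "\<exists>e. \<forall>x y. (a * x + b * y) ^ k * (c * x + d * y) ^ n = (\<Sum>i\<le>k + n. e i * x ^ (k + n - i) * y ^ i)"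
proof -
  have mult: "\<exists>e'. \<forall>x y. (a * x + b * y) * q x y = (\<Sum>i\<le>Suc m. e' i * x ^ (Suc m - i) * y ^ i)"
    if q: "\<forall>x y. q x y = (\<Sum>i\<le>m. e i * x ^ (m - i) * y ^ i)"
    for a b :: complex and q :: "complex \<Rightarrow> complex \<Rightarrow> complex" and e m
  proof (intro exI allI)
    fix x y
    \<comment> \<open>Multiplying by \<open>y\<close> shifts the coefficients by one. The guards
      remove the top term of the unshifted sequence and the bottom term of the shifted one, where
      \<open>e (i - 1)\<close> would wrongly read \<open>e 0\<close>.\<close>
    let ?e = "\<lambda>i. (if i \<le> m then a * e i else 0) + (if i = 0 then 0 else b * e (i - 1))"
    have "(\<Sum>i\<le>Suc m. (if i \<le> m then a * e i else 0) * x ^ (Suc m - i) * y ^ i) =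
        (\<Sum>i\<le>m. a * x * (e i * x ^ (m - i) * y ^ i))"
      by (simp add: Suc_diff_le mult_ac)
    moreover have "(\<Sum>i\<le>Suc m. (if i = 0 then 0 else b * e (i - 1)) * x ^ (Suc m - i) * y ^ i) =
        (\<Sum>i\<le>m. b * y * (e i * x ^ (m - i) * y ^ i))"
      by (subst sum.atMost_Suc_shift) (simp add: mult_ac)
    ultimately show "(a * x + b * y) * q x y = (\<Sum>i\<le>Suc m. ?e i * x ^ (Suc m - i) * y ^ i)"
      by (simp add: q distrib_right sum.distrib sum_distrib_left del: sum.atMost_Suc)
  qed
  have n: "\<exists>e. \<forall>x y. (c * x + d * y) ^ n = (\<Sum>i\<le>n. e i * x ^ (n - i) * y ^ i)"
  proof (induction n)
    case (Suc n)
    then obtain e where "\<forall>x y. (c * x + d * y) ^ n = (\<Sum>i\<le>n. e i * x ^ (n - i) * y ^ i)" by blast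
    from mult[OF this, of c d] show ?case by simp
  qed auto
  show ?thesis
  proof (induction k)
    case 0
    then show ?case using n by simp
  next
    case (Suc k)
    then obtain e where "\<forall>x y. (a * x + b * y) ^ k * (c * x + d * y) ^ n =
        (\<Sum>i\<le>k + n. e i * x ^ (k + n - i) * y ^ i)" by blast
    from mult[OF this, of a b] show ?case by (simp add: mult.assoc)
  qed
qed

text \<open>To reach total degree \<open>k\<close>, choose the linear term in \<open>j\<close> of
  the \<open>n\<close> second factors and in \<open>k - j\<close> of the \<open>k\<close> first
  ones; the remaining \<open>j\<close> first factors contribute \<open>x\<close>.\<close>

lemma coeff_linear_power_product:
  fixes x y A B :: "'a::comm_ring_1"
  shows "coeff ([:x, A:] ^ k * [:B, y:] ^ n) k =
    (\<Sum>j\<le>k. of_nat (k choose j) * of_nat (n choose j) * (x * y) ^ j * A ^ (k - j) * B ^ (n - j))"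
proof -
  \<comment> \<open>For \<open>j > n\<close> both sides are 0, so the truncated exponent
    \<open>n - j\<close> does no harm.\<close>
  have n: "coeff ([:B, y:] ^ n) j = of_nat (n choose j) * y ^ j * B ^ (n - j)" for j
  proof (cases "j \<le> n")
    case False
    have "degree ([:B, y:] ^ n) \<le> 1 * n"
      by (rule order_trans[OF degree_power_le]) simp
    then show ?thesis using False by (simp add: coeff_eq_0 binomial_eq_0)
  qed (rule coeff_linear_poly_power)
  have "coeff ([:x, A:] ^ k * [:B, y:] ^ n) k = (\<Sum>j\<le>k. coeff ([:B, y:] ^ n) j * coeff ([:x, A:] ^ k) (k - j))"
    by (subst mult.commute) (rule coeff_mult)
  also have "\<dots> = (\<Sum>j\<le>k. of_nat (k choose j) * of_nat (n choose j) * (x * y) ^ j * A ^ (k - j) * B ^ (n - j))"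
  proof (intro sum.cong refl)
    fix j assume "j \<in> {..k}"
    then show "coeff ([:B, y:] ^ n) j * coeff ([:x, A:] ^ k) (k - j) =
      of_nat (k choose j) * of_nat (n choose j) * (x * y) ^ j * A ^ (k - j) * B ^ (n - j)"
      by (simp add: n coeff_linear_poly_power binomial_symmetric[of j k] power_mult_distrib mult_ac)
  qed
  finally show ?thesis .
qed

text \<open>Pairing with the \<open>(k + n)\<close>-th power of a linear form evaluates the
  homogenised \<open>p\<close> at the conjugated coefficients of that form, because the binomials of
  the power cancel the weights. The result factors, and its coefficient at degree \<open>k\<close>
  contains the pairing of \<open>p\<close> with itself.\<close>

lemma inner_H_linear_powers:
  fixes s \<xi> :: complex and k n :: nat
  defines "p \<equiv> \<lambda>w. (s - w) ^ k * (1 + cnj \<xi> * w) ^ n"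
  shows "inner_H (k + n) p p = complex_of_real (1 / real ((k + n) choose k) *
    (\<Sum>j\<le>k. real (k choose j) * real (n choose j) * ((cmod (s - \<xi>))\<^sup>2) ^ j
        * (1 + (cmod s)\<^sup>2) ^ (k - j) * (1 + (cmod \<xi>)\<^sup>2) ^ (n - j)))"
proof -
  define A B where "A = 1 + s * cnj s" and "B = 1 + \<xi> * cnj \<xi>"
  \<comment> \<open>Up to binomial coefficients, these are the coefficients in \<open>t\<close> of
    the powers \<open>Q\<close> below; the member with index \<open>k\<close> is
    \<open>p\<close>.\<close>
  define q where "q = (\<lambda>i w. (s - w) ^ i * (1 + cnj \<xi> * w) ^ (k + n - i))"
  obtain e where e: "\<And>x y. (s * x + (- 1) * y) ^ k * (1 * x + cnj \<xi> * y) ^ n = (\<Sum>i\<le>k + n. e i * x ^ (k + n - i) * y ^ i)"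
    using linear_form_power_product_expand[of s "-1" k 1 "cnj \<xi>" n] by blast
  have p: "p w = (\<Sum>i\<le>k + n. e i * w ^ i)" for w
    using e[of 1 w] by (simp add: p_def)
  have "\<exists>c. \<forall>w. q i w = (\<Sum>j\<le>k + n. c j * w ^ j)" if "i \<le> k + n" for i
  proof -
    obtain c where c: "\<And>x y. (s * x + (- 1) * y) ^ i * (1 * x + cnj \<xi> * y) ^ (k + n - i)
        = (\<Sum>j\<le>i + (k + n - i). c j * x ^ (i + (k + n - i) - j) * y ^ j)"
      using linear_form_power_product_expand[of s "-1" i 1 "cnj \<xi>" "k + n - i"] by blast
    have "q i w = (\<Sum>j\<le>k + n. c j * w ^ j)" for w
      using c[of 1 w] that by (simp add: q_def)
    then show ?thesis by blast
  qed
  then obtain c where c: "\<And>i w. i \<le> k + n \<Longrightarrow> q i w = (\<Sum>j\<le>k + n. c i j * w ^ j)"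
    by metis
  have qk: "q k = p" by (simp add: q_def p_def)
  have gen: "(\<Sum>i\<le>k + n. of_nat ((k + n) choose i) * inner_H (k + n) p (q i) * u ^ i) =
     ((s - \<xi>) + A * u) ^ k * (B + cnj (s - \<xi>) * u) ^ n" for u
  proof -
    \<comment> \<open>The inner product is conjugate linear in its second argument, so the parameter
      is conjugated to obtain a polynomial in \<open>u\<close>.\<close>
    define t where "t = cnj u"
    have u: "u = cnj t" by (simp add: t_def)
    \<comment> \<open>This is \<open>(t * (s - w) + (1 + cnj \<xi> * w)) ^ (k + n)\<close>,
      regrouped as a power of a linear form in \<open>w\<close>. \<open>Q1\<close> expands it in
      \<open>w\<close>, \<open>Q2\<close> first in \<open>t\<close>.\<close>
    define Q where "Q = (\<lambda>w. ((1 + t * s) + (cnj \<xi> - t) * w) ^ (k + n))"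
    have Q1: "Q w = (\<Sum>j\<le>k + n. (of_nat ((k + n) choose j) * (1 + t * s) ^ (k + n - j) * (cnj \<xi> - t) ^ j) * w ^ j)" for w
      using binomial_ring[of "(cnj \<xi> - t) * w" "1 + t * s" "k + n"]
      by (simp add: Q_def power_mult_distrib mult_ac add.commute)
    have Q2: "Q w = (\<Sum>j\<le>k + n. (\<Sum>i\<le>k + n. of_nat ((k + n) choose i) * t ^ i * c i j) * w ^ j)" for w
    proof -
      have "Q w = (t * (s - w) + (1 + cnj \<xi> * w)) ^ (k + n)"
        by (simp add: Q_def algebra_simps)
      also have "\<dots> = (\<Sum>i\<le>k + n. of_nat ((k + n) choose i) * t ^ i * q i w)"
        by (simp add: binomial_ring q_def power_mult_distrib mult_ac)
      also have "\<dots> = (\<Sum>i\<le>k + n. \<Sum>j\<le>k + n. of_nat ((k + n) choose i) * t ^ i * c i j * w ^ j)"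
        by (intro sum.cong refl) (simp add: c sum_distrib_left mult_ac)
      finally show ?thesis
        unfolding sum_distrib_right by (subst sum.swap)
    qed
    have "(\<Sum>i\<le>k + n. of_nat ((k + n) choose i) * inner_H (k + n) p (q i) * u ^ i) =
       (\<Sum>i\<le>k + n. of_nat ((k + n) choose i) * (\<Sum>j\<le>k + n. e j * cnj (c i j) / of_nat ((k + n) choose j)) * u ^ i)"
      by (intro sum.cong refl) (simp add: inner_H_coeffs[OF p c])
    also have "\<dots> = (\<Sum>j\<le>k + n. \<Sum>i\<le>k + n. of_nat ((k + n) choose i) * (e j * cnj (c i j) / of_nat ((k + n) choose j)) * u ^ i)"
      unfolding sum_distrib_left sum_distrib_right by (rule sum.swap)
    also have "\<dots> = inner_H (k + n) p Q"
      unfolding inner_H_coeffs[OF p Q2] cnj_sum sum_distrib_left sum_divide_distrib u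
      by (intro sum.cong refl) simp
    also have "\<dots> = (\<Sum>i\<le>k + n. e i * cnj (1 + t * s) ^ (k + n - i) * cnj (cnj \<xi> - t) ^ i)"
      unfolding inner_H_coeffs[OF p Q1] by (intro sum.cong refl) auto
    also have "\<dots> = (s * cnj (1 + t * s) + (- 1) * cnj (cnj \<xi> - t)) ^ k * (1 * cnj (1 + t * s) + cnj \<xi> * cnj (cnj \<xi> - t)) ^ n"
      by (rule e[symmetric])
    also have "s * cnj (1 + t * s) + (- 1) * cnj (cnj \<xi> - t) = (s - \<xi>) + A * u"
      by (simp add: A_def u algebra_simps)
    also have "1 * cnj (1 + t * s) + cnj \<xi> * cnj (cnj \<xi> - t) = B + cnj (s - \<xi>) * u"
      by (simp add: B_def u algebra_simps)
    finally show ?thesis .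
  qed
  \<comment> \<open>The identity \<open>gen\<close> holds for all complex \<open>u\<close>, hence
    between polynomials, and coefficients may be compared.\<close>
  let ?L = "\<Sum>i\<le>k + n. monom (of_nat ((k + n) choose i) * inner_H (k + n) p (q i)) i"
  have "poly ?L = poly ([:s - \<xi>, A:] ^ k * [:B, cnj (s - \<xi>):] ^ n)"
  proof
    fix u
    show "poly ?L u = poly ([:s - \<xi>, A:] ^ k * [:B, cnj (s - \<xi>):] ^ n) u"
      using gen[of u] by (simp add: poly_sum poly_monom mult.commute[of u])
  qed
  then have "?L = [:s - \<xi>, A:] ^ k * [:B, cnj (s - \<xi>):] ^ n"
    by (simp only: poly_eq_poly_eq_iff)
  then have "coeff ?L k = coeff ([:s - \<xi>, A:] ^ k * [:B, cnj (s - \<xi>):] ^ n) k" by simp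
  moreover have "coeff ?L k = of_nat ((k + n) choose k) * inner_H (k + n) p p"
    by (simp add: coeff_sum qk)
  ultimately have "of_nat ((k + n) choose k) * inner_H (k + n) p p =
    (\<Sum>j\<le>k. of_nat (k choose j) * of_nat (n choose j) * ((s - \<xi>) * cnj (s - \<xi>)) ^ j * A ^ (k - j) * B ^ (n - j))"
    by (simp only: coeff_linear_power_product)
  moreover have "A = complex_of_real (1 + (cmod s)\<^sup>2)" "B = complex_of_real (1 + (cmod \<xi>)\<^sup>2)"
    "(s - \<xi>) * cnj (s - \<xi>) = complex_of_real ((cmod (s - \<xi>))\<^sup>2)"
    by (simp_all only: A_def B_def of_real_add of_real_1 complex_norm_square)
  ultimately have "of_nat ((k + n) choose k) * inner_H (k + n) p p = complex_of_real
    (\<Sum>j\<le>k. real (k choose j) * real (n choose j) * ((cmod (s - \<xi>))\<^sup>2) ^ j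
        * (1 + (cmod s)\<^sup>2) ^ (k - j) * (1 + (cmod \<xi>)\<^sup>2) ^ (n - j))"
    by simp
  then show ?thesis
    by (simp add: field_simps)
qed

text \<open>For \<open>m \<le> j \<le> n\<close>, \<open>(n choose j) * (j choose m) = (n choose m)
  * ((n - m) choose (j - m))\<close>. Reflecting the last binomial to
  \<open>(n - m) choose (n - j)\<close> makes the sum over \<open>j\<close> a Vandermonde
  convolution.\<close>

lemma sum_choose_triple:
  assumes "m \<le> k"
  shows "(\<Sum>j\<le>k. (k choose j) * (n choose j) * (j choose m)) = (n choose m) * ((k + n - m) choose n)"
proof (cases "m \<le> n")
  case True
  \<comment> \<open>Vandermonde needs the range up to \<open>n\<close>; the terms beyond
    \<open>k\<close> or beyond \<open>n\<close> vanish.\<close>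
  have "(\<Sum>j\<le>k. (k choose j) * (n choose j) * (j choose m)) =
      (\<Sum>j\<in>{..k} \<inter> {..n}. (k choose j) * (n choose j) * (j choose m))"
    by (rule sum.mono_neutral_right) auto
  also have "\<dots> = (\<Sum>j\<le>n. (k choose j) * (n choose j) * (j choose m))"
    by (rule sum.mono_neutral_left) auto
  also have "\<dots> = (\<Sum>j\<le>n. (n choose m) * ((k choose j) * ((n - m) choose (n - j))))"
  proof (intro sum.cong refl)
    fix j assume j: "j \<in> {..n}"
    show "(k choose j) * (n choose j) * (j choose m) = (n choose m) * ((k choose j) * ((n - m) choose (n - j)))"
    proof (cases "m \<le> j")
      case mj: True
      have "(n choose j) * (j choose m) = (n choose m) * ((n - m) choose (j - m))"
        using mj j by (intro choose_mult) auto
      also have "(n - m) choose (j - m) = (n - m) choose (n - j)"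
        using mj j by (subst binomial_symmetric) auto
      finally show ?thesis by (simp add: mult_ac)
    next
      case False
      then have "n - m < n - j" using j True by auto
      then show ?thesis using False by (simp add: binomial_eq_0)
    qed
  qed
  also have "\<dots> = (n choose m) * ((k + (n - m)) choose n)"
    by (simp only: vandermonde sum_distrib_left[symmetric])
  finally show ?thesis using True by simp
next
  case False
  have "(n choose j) * (j choose m) = 0" for j
    using False by (cases "j \<le> n") (auto simp: binomial_eq_0)
  then show ?thesis using False by (simp add: binomial_eq_0 mult.assoc)
qed

text \<open>Expanding \<open>(A * B - T) ^ j\<close> and exchanging the sums leaves, for each power
  of \<open>T\<close>, the sum of \<open>sum_choose_triple\<close>. In the application
  \<open>A * B - T\<close> is |s - \<xi>|^2 as given by Lagrange's identity.\<close>

lemma sum_choose_choose_power_diff: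
  fixes A B T :: real
  shows "1 / real ((k + n) choose k) *
      (\<Sum>j\<le>k. real (k choose j) * real (n choose j) * (A * B - T) ^ j * A ^ (k - j) * B ^ (n - j)) =
    (\<Sum>l=0..k. ((-1) ^ (k - l) * real (n choose (k - l)) * (fact (n + l) * fact k) / (fact (k + n) * fact l))
        * (T ^ (k - l) * A ^ l * B ^ (n - (k - l))))"
proof -
  have "(\<Sum>j\<le>k. real (k choose j) * real (n choose j) * (A * B - T) ^ j * A ^ (k - j) * B ^ (n - j)) =
    (\<Sum>j\<le>k. \<Sum>m\<le>k. real ((k choose j) * (n choose j) * (j choose m)) * ((-T) ^ m * A ^ (k - m) * B ^ (n - m)))"
  proof (intro sum.cong refl)
    fix j assume j: "j \<in> {..k}"
    show "real (k choose j) * real (n choose j) * (A * B - T) ^ j * A ^ (k - j) * B ^ (n - j) =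
      (\<Sum>m\<le>k. real ((k choose j) * (n choose j) * (j choose m)) * ((-T) ^ m * A ^ (k - m) * B ^ (n - m)))"
    \<comment> \<open>The splitting \<open>n - m = (j - m) + (n - j)\<close> holds only for
      \<open>j \<le> n\<close>; otherwise \<open>n choose j\<close> is 0.\<close>
    proof (cases "j \<le> n")
      case True
      have "(\<Sum>m\<le>k. real ((k choose j) * (n choose j) * (j choose m)) * ((-T) ^ m * A ^ (k - m) * B ^ (n - m))) =
          (\<Sum>m\<le>j. real ((k choose j) * (n choose j) * (j choose m)) * ((-T) ^ m * A ^ (k - m) * B ^ (n - m)))"
        using j by (intro sum.mono_neutral_right) (auto simp: binomial_eq_0)
      also have "\<dots> = (\<Sum>m\<le>j. real (k choose j) * real (n choose j) * (real (j choose m) * (-T) ^ m * (A * B) ^ (j - m))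
          * A ^ (k - j) * B ^ (n - j))"
      proof (intro sum.cong refl)
        fix m assume m: "m \<in> {..j}"
        have "k - m = (j - m) + (k - j)" "n - m = (j - m) + (n - j)" using m j True by auto
        then show "real ((k choose j) * (n choose j) * (j choose m)) * ((-T) ^ m * A ^ (k - m) * B ^ (n - m)) =
          real (k choose j) * real (n choose j) * (real (j choose m) * (-T) ^ m * (A * B) ^ (j - m))
          * A ^ (k - j) * B ^ (n - j)"
          by (simp only: power_add power_mult_distrib of_nat_mult mult_ac)
      qed
      also have "\<dots> = real (k choose j) * real (n choose j) * ((-T) + A * B) ^ j * A ^ (k - j) * B ^ (n - j)"
        unfolding binomial_ring sum_distrib_left sum_distrib_right ..
      finally show ?thesis by simp
    qed (simp add: binomial_eq_0)
  qed
  also have "\<dots> = (\<Sum>m\<le>k. \<Sum>j\<le>k. real ((k choose j) * (n choose j) * (j choose m)) * ((-T) ^ m * A ^ (k - m) * B ^ (n - m)))"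
    by (rule sum.swap)
  also have "\<dots> = (\<Sum>m\<le>k. real ((n choose m) * ((k + n - m) choose n)) * ((-T) ^ m * A ^ (k - m) * B ^ (n - m)))"
  proof (intro sum.cong refl)
    fix m assume "m \<in> {..k}"
    then have triple: "(\<Sum>j\<le>k. (k choose j) * (n choose j) * (j choose m)) = (n choose m) * ((k + n - m) choose n)"
      by (intro sum_choose_triple) simp
    show "(\<Sum>j\<le>k. real ((k choose j) * (n choose j) * (j choose m)) * ((-T) ^ m * A ^ (k - m) * B ^ (n - m))) =
      real ((n choose m) * ((k + n - m) choose n)) * ((-T) ^ m * A ^ (k - m) * B ^ (n - m))"
      unfolding triple[symmetric] of_nat_sum sum_distrib_right ..
  qed
  \<comment> \<open>Substituting \<open>l = k - m\<close> turns \<open>k + n - m\<close> into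
    \<open>n + l\<close>.\<close>
  also have "\<dots> = (\<Sum>l=0..k. real ((n choose (k - l)) * ((n + l) choose n)) * ((-T) ^ (k - l) * A ^ l * B ^ (n - (k - l))))"
    by (rule sum.reindex_bij_witness[of _ "\<lambda>l. k - l" "\<lambda>m. k - m"]) (auto simp: add.commute)
  finally have "1 / real ((k + n) choose k) *
      (\<Sum>j\<le>k. real (k choose j) * real (n choose j) * (A * B - T) ^ j * A ^ (k - j) * B ^ (n - j)) =
    (\<Sum>l=0..k. 1 / real ((k + n) choose k) * (real ((n choose (k - l)) * ((n + l) choose n)) * ((-T) ^ (k - l) * A ^ l * B ^ (n - (k - l)))))"
    by (simp only: sum_distrib_left)
  also have "\<dots> = (\<Sum>l=0..k. ((-1) ^ (k - l) * real (n choose (k - l)) * (fact (n + l) * fact k) / (fact (k + n) * fact l))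
        * (T ^ (k - l) * A ^ l * B ^ (n - (k - l))))"
  proof (intro sum.cong refl)
    fix l
    have "real ((n + l) choose n) / real ((k + n) choose k) = fact (n + l) * fact k / (fact (k + n) * fact l)"
      by (simp add: binomial_fact)
    then have "1 / real ((k + n) choose k) * (real ((n choose (k - l)) * ((n + l) choose n)) * ((-T) ^ (k - l) * A ^ l * B ^ (n - (k - l))))
      = real (n choose (k - l)) * (fact (n + l) * fact k / (fact (k + n) * fact l)) * ((-1) ^ (k - l) * T ^ (k - l) * A ^ l * B ^ (n - (k - l)))"
      by (simp add: power_minus[of T] field_simps)
    then show "1 / real ((k + n) choose k) * (real ((n choose (k - l)) * ((n + l) choose n)) * ((-T) ^ (k - l) * A ^ l * B ^ (n - (k - l))))
      = ((-1) ^ (k - l) * real (n choose (k - l)) * (fact (n + l) * fact k) / (fact (k + n) * fact l))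
        * (T ^ (k - l) * A ^ l * B ^ (n - (k - l)))"
      by (simp add: mult_ac)
  qed
  finally show ?thesis .
qed

section \<open>The operators \<open>J_k\<close> and the main formula\<close>

text \<open>The conjugate of the factor multiplying \<open>F\<close> in \<open>J_op\<close>, so that
  \<open>J_op\<close> at \<xi> becomes a pairing with a polynomial in \<open>z\<close> and
  \<open>w\<close>.\<close>

definition J_kernel :: "nat \<Rightarrow> nat \<Rightarrow> nat \<Rightarrow> complex \<Rightarrow> complex \<Rightarrow> complex \<Rightarrow> complex" where
  "J_kernel \<mu> \<nu> k \<xi> z w = (z - w) ^ k * (1 + cnj \<xi> * z) ^ (\<mu> - k) * (1 + cnj \<xi> * w) ^ (\<nu> - k)"

lemma J_op_eq_inner_T: "J_op \<mu> \<nu> k F \<xi> = inner_T \<mu> \<nu> F (J_kernel \<mu> \<nu> k \<xi>)"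
  by (simp add: J_op_def inner_T_def J_kernel_def mult_ac)

text \<open>Separates the powers of \<open>cnj \<xi>\<close> from the monomials in \<open>z\<close>
  and \<open>w\<close>. The degrees are bounded by \<mu> in \<open>z\<close>, \<nu> in
  \<open>w\<close> and \<mu> + \<nu> - 2k in \<open>cnj \<xi>\<close>, which gives the two
  membership lemmas that follow.\<close>

lemma J_kernel_expand:
  "J_kernel \<mu> \<nu> k \<xi> z w = (\<Sum>p\<le>k. \<Sum>a\<le>\<mu> - k. \<Sum>b\<le>\<nu> - k.
     (of_nat (k choose p) * (-1) ^ (k - p) * of_nat ((\<mu> - k) choose a) * of_nat ((\<nu> - k) choose b) * cnj \<xi> ^ (a + b))
       * (z ^ (p + a) * w ^ (k - p + b)))"
proof -
  have 1: "(z - w) ^ k = (\<Sum>p\<le>k. of_nat (k choose p) * z ^ p * (- w) ^ (k - p))"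
    using binomial_ring[of z "- w" k] by simp
  have 2: "(1 + cnj \<xi> * z) ^ m = (\<Sum>a\<le>m. of_nat (m choose a) * (cnj \<xi> * z) ^ a)" for z m
    using binomial_ring[of "cnj \<xi> * z" 1 m] by (simp add: add.commute)
  have "J_kernel \<mu> \<nu> k \<xi> z w = (\<Sum>p\<le>k. \<Sum>a\<le>\<mu> - k. \<Sum>b\<le>\<nu> - k.
      of_nat (k choose p) * z ^ p * (- w) ^ (k - p) * (of_nat ((\<mu> - k) choose a) * (cnj \<xi> * z) ^ a)
       * (of_nat ((\<nu> - k) choose b) * (cnj \<xi> * w) ^ b))"
    unfolding J_kernel_def 1 2 mult.assoc sum_distrib_right
    unfolding sum_distrib_left mult.assoc ..
  also have "\<dots> = (\<Sum>p\<le>k. \<Sum>a\<le>\<mu> - k. \<Sum>b\<le>\<nu> - k.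
     (of_nat (k choose p) * (-1) ^ (k - p) * of_nat ((\<mu> - k) choose a) * of_nat ((\<nu> - k) choose b) * cnj \<xi> ^ (a + b))
       * (z ^ (p + a) * w ^ (k - p + b)))"
    by (intro sum.cong refl) (simp only: power_add power_mult_distrib power_minus[of w] mult_ac)
  finally show ?thesis .
qed

lemma J_kernel_in_tpolys:
  assumes "k \<le> \<mu>" "k \<le> \<nu>"
  shows "J_kernel \<mu> \<nu> k \<xi> \<in> tpolys \<mu> \<nu>"
  unfolding J_kernel_expand[abs_def]
  by (intro tpolys_sum tpolys_cmult tpolys_monom) (use assms in auto)

text \<open>Needed before the reproducing property can be applied to \<open>P_op\<close>. Conjugate
  linearity in the second argument turns \<open>cnj \<xi>\<close> into \<xi>.\<close>

lemma J_op_in_polys: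
  assumes k: "k \<le> \<mu>" "k \<le> \<nu>" and F: "F \<in> tpolys \<mu> \<nu>"
  shows "J_op \<mu> \<nu> k F \<in> polys (\<mu> + \<nu> - 2 * k)"
proof -
  let ?m = "\<lambda>p a b. inner_T \<mu> \<nu> F (\<lambda>z w. z ^ (p + a) * w ^ (k - p + b))"
  let ?c = "\<lambda>p a b. of_nat (k choose p) * (-1) ^ (k - p) * of_nat ((\<mu> - k) choose a) * of_nat ((\<nu> - k) choose b) :: complex"
  have "J_op \<mu> \<nu> k F = (\<lambda>\<xi>. \<Sum>p\<le>k. \<Sum>a\<le>\<mu> - k. \<Sum>b\<le>\<nu> - k. (?c p a b * ?m p a b) * \<xi> ^ (a + b))"
  proof
    fix \<xi>
    have mon: "(\<lambda>z w. z ^ (p + a) * w ^ (k - p + b)) \<in> tpolys \<mu> \<nu>"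
      if "p \<le> k" "a \<le> \<mu> - k" "b \<le> \<nu> - k" for p a b
      using that k by (intro tpolys_monom) auto
    have "J_op \<mu> \<nu> k F \<xi> = (\<Sum>p\<le>k. inner_T \<mu> \<nu> F (\<lambda>z w. \<Sum>a\<le>\<mu> - k. \<Sum>b\<le>\<nu> - k.
        (?c p a b * cnj \<xi> ^ (a + b)) * (z ^ (p + a) * w ^ (k - p + b))))"
      unfolding J_op_eq_inner_T J_kernel_expand[abs_def]
      by (intro inner_T_sum_right F tpolys_sum tpolys_cmult mon) auto
    also have "\<dots> = (\<Sum>p\<le>k. \<Sum>a\<le>\<mu> - k. inner_T \<mu> \<nu> F (\<lambda>z w. \<Sum>b\<le>\<nu> - k.
        (?c p a b * cnj \<xi> ^ (a + b)) * (z ^ (p + a) * w ^ (k - p + b))))"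
      by (intro sum.cong refl inner_T_sum_right F tpolys_sum tpolys_cmult mon) auto
    also have "\<dots> = (\<Sum>p\<le>k. \<Sum>a\<le>\<mu> - k. \<Sum>b\<le>\<nu> - k. inner_T \<mu> \<nu> F (\<lambda>z w.
        (?c p a b * cnj \<xi> ^ (a + b)) * (z ^ (p + a) * w ^ (k - p + b))))"
      by (intro sum.cong refl inner_T_sum_right F tpolys_sum tpolys_cmult mon) auto
    also have "\<dots> = (\<Sum>p\<le>k. \<Sum>a\<le>\<mu> - k. \<Sum>b\<le>\<nu> - k. (?c p a b * ?m p a b) * \<xi> ^ (a + b))"
      unfolding inner_T_cmult_right by (intro sum.cong refl) simp
    finally show "J_op \<mu> \<nu> k F \<xi> = \<dots>" .
  qed
  moreover have "(\<lambda>\<xi>. \<Sum>p\<le>k. \<Sum>a\<le>\<mu> - k. \<Sum>b\<le>\<nu> - k. (?c p a b * ?m p a b) * \<xi> ^ (a + b)) \<in> polys (\<mu> + \<nu> - 2 * k)"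
    by (intro polys_sum polys_cmult polys_monom) (use k in auto)
  ultimately show ?thesis by (simp only:)
qed

text \<open>Pairing \<open>P_op \<mu> \<nu> k F\<close> with the kernel function evaluates it at
  \<xi>, which is \<open>Cc\<close> times the pairing of \<open>F\<close> with
  \<open>J_kernel\<close>; \<open>Cc\<close> is real, so it passes into the second argument
  unchanged. Uniqueness is \<open>tpolys_inner_T_eqI\<close>.\<close>

lemma P_adj_kern:
  assumes k: "k \<le> \<mu>" "k \<le> \<nu>"
  shows "P_adj \<mu> \<nu> k (kern (\<mu> + \<nu> - 2 * k) \<xi>) =
    (\<lambda>z w. complex_of_real (Cc \<mu> \<nu> k) * J_kernel \<mu> \<nu> k \<xi> z w)"
proof -
  let ?G = "\<lambda>z w. complex_of_real (Cc \<mu> \<nu> k) * J_kernel \<mu> \<nu> k \<xi> z w"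
  have G: "?G \<in> tpolys \<mu> \<nu>" by (intro tpolys_cmult J_kernel_in_tpolys k)
  have adj: "inner_H (\<mu> + \<nu> - 2 * k) (P_op \<mu> \<nu> k F) (kern (\<mu> + \<nu> - 2 * k) \<xi>) = inner_T \<mu> \<nu> F ?G"
    if "F \<in> tpolys \<mu> \<nu>" for F
  proof -
    have "P_op \<mu> \<nu> k F \<in> polys (\<mu> + \<nu> - 2 * k)"
      unfolding P_op_def by (intro polys_cmult J_op_in_polys[unfolded eta_contract_eq] k that)
    then show ?thesis
      by (simp add: inner_H_kern P_op_def J_op_eq_inner_T inner_T_cmult_right)
  qed
  show ?thesis
    unfolding P_adj_def
  proof (rule the_equality)
    fix G' assume G': "G' \<in> tpolys \<mu> \<nu> \<and> (\<forall>F\<in>tpolys \<mu> \<nu>.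
       inner_H (\<mu> + \<nu> - 2 * k) (P_op \<mu> \<nu> k F) (kern (\<mu> + \<nu> - 2 * k) \<xi>) = inner_T \<mu> \<nu> F G')"
    show "G' = ?G"
      by (rule tpolys_inner_T_eqI[OF _ G]) (use G' adj in auto)
  qed (use G adj in auto)
qed

text \<open>The two Pochhammer symbols at negative integers have the same sign
  \<open>(-1) ^ k\<close>. The result makes \<open>Cc\<close> square to \<open>Csq\<close>.\<close>

lemma Csq_nonneg:
  assumes "k \<le> \<mu>" "k \<le> \<nu>"
  shows "Csq \<mu> \<nu> k \<ge> 0"
proof -
  have "((-1) ^ k * x) * ((-1) ^ k * y) = x * y" for x y :: real
    by (cases "even k") auto
  then have "pochhammer (- real \<nu>) k * pochhammer (- real \<mu>) k =
      pochhammer (real \<nu> - real k + 1) k * pochhammer (real \<mu> - real k + 1) k"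
    by (simp only: pochhammer_minus)
  moreover have "pochhammer (real m - real k + 1) k \<ge> 0" if "k \<le> m" for m
    using that by (intro pochhammer_nonneg) simp
  moreover have "pochhammer (real (\<mu> + \<nu> - 2 * k + 2)) k \<ge> 0"
    by (intro pochhammer_nonneg) simp
  ultimately show ?thesis
    using assms unfolding Csq_def by (intro divide_nonneg_nonneg) auto
qed

section \<open>Squared norms of \<open>J_kernel\<close> and the Berezin kernels\<close>

lemma inner_H_cmult: "inner_H \<tau> (\<lambda>w. a * p w) (\<lambda>w. b * q w) = a * cnj b * inner_H \<tau> p q"
proof -
  have "inner_H \<tau> (\<lambda>w. a * p w) (\<lambda>w. b * q w) = (LINT z|lborel. (a * cnj b) *
      (complex_of_real (iota_w \<tau> z) * (p z * cnj (q z))))"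
    unfolding inner_H_def int_iota_def by (simp add: mult_ac)
  then show ?thesis by (simp only: inner_H_def int_iota_def integral_mult_right_zero)
qed

lemma cmod_diff_squared_Lagrange:
  "(cmod (s - \<xi>))\<^sup>2 = (1 + (cmod s)\<^sup>2) * (1 + (cmod \<xi>)\<^sup>2) - (cmod (1 + \<xi> * cnj s))\<^sup>2"
  unfolding cmod_power2 by (simp add: power2_eq_square algebra_simps)

text \<open>For fixed \<open>s\<close> the factor \<open>(1 + cnj \<xi> * s) ^ (\<mu> - k)\<close>
  is constant in \<open>w\<close> and contributes its squared modulus; the rest is the product of
  powers treated in \<open>inner_H_linear_powers\<close>.\<close>

lemma inner_H_J_kernel:
  assumes k: "k \<le> \<mu>" "k \<le> \<nu>"
  defines "T \<equiv> \<lambda>\<xi> s. (cmod (1 + \<xi> * cnj s))\<^sup>2"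
  shows "inner_H \<nu> (J_kernel \<mu> \<nu> k \<xi> s) (J_kernel \<mu> \<nu> k \<xi> s) = complex_of_real (T \<xi> s ^ (\<mu> - k) *
    (\<Sum>l=0..k. ((-1) ^ (k - l) * real ((\<nu> - k) choose (k - l)) * (fact (\<nu> - k + l) * fact k) / (fact \<nu> * fact l))
        * (T \<xi> s ^ (k - l) * (1 + (cmod s)\<^sup>2) ^ l * (1 + (cmod \<xi>)\<^sup>2) ^ (\<nu> - k - (k - l)))))"
proof -
  let ?p = "\<lambda>w. (s - w) ^ k * (1 + cnj \<xi> * w) ^ (\<nu> - k)"
  let ?a = "(1 + cnj \<xi> * s) ^ (\<mu> - k)"
  have \<nu>: "k + (\<nu> - k) = \<nu>" using k by simp
  have "J_kernel \<mu> \<nu> k \<xi> s = (\<lambda>w. ?a * ?p w)"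
    by (simp add: J_kernel_def fun_eq_iff mult_ac)
  then have "inner_H \<nu> (J_kernel \<mu> \<nu> k \<xi> s) (J_kernel \<mu> \<nu> k \<xi> s) = ?a * cnj ?a * inner_H \<nu> ?p ?p"
    by (simp only: inner_H_cmult)
  also have "?a * cnj ?a = complex_of_real (T \<xi> s ^ (\<mu> - k))"
  proof -
    have "cmod (1 + cnj \<xi> * s) = cmod (1 + \<xi> * cnj s)"
      using complex_mod_cnj[of "1 + cnj \<xi> * s"] by simp
    then have "complex_of_real (T \<xi> s) = (1 + cnj \<xi> * s) * cnj (1 + cnj \<xi> * s)"
      unfolding T_def complex_norm_square[symmetric] by simp
    then show ?thesis by (simp add: power_mult_distrib)
  qed
  also have "inner_H \<nu> ?p ?p = complex_of_real (\<Sum>l=0..k. ((-1) ^ (k - l) * real ((\<nu> - k) choose (k - l)) * (fact (\<nu> - k + l) * fact k) / (fact \<nu> * fact l))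
        * (T \<xi> s ^ (k - l) * (1 + (cmod s)\<^sup>2) ^ l * (1 + (cmod \<xi>)\<^sup>2) ^ (\<nu> - k - (k - l))))"
    using inner_H_linear_powers[of k "\<nu> - k" s \<xi>]
    unfolding cmod_diff_squared_Lagrange sum_choose_choose_power_diff
    unfolding \<nu> T_def .
  finally show ?thesis by (simp only: of_real_mult)
qed

text \<open>Lagrange's identity also yields the Cauchy-Schwarz bound |1 + z cnj(s)|^2 \<le> (1 +
  |z|^2)(1 + |s|^2), so the Berezin kernel is at most 1 and the integrand is as bounded as
  \<open>f\<close>.\<close>

lemma has_int_iota_berezin:
  assumes f: "f \<in> C_CP1"
  shows "has_int_iota 0 (\<lambda>s. complex_of_real ((cmod (1 + z * cnj s)) ^ (2 * \<tau>) /
      ((1 + (cmod z)^2) ^ \<tau> * (1 + (cmod s)^2) ^ \<tau>)) * f s) (berezin \<tau> f z)"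
proof -
  obtain K where K: "\<And>z. norm (f z) \<le> K" using C_CP1_bounded[OF f] by blast
  have [measurable]: "f \<in> borel_measurable borel" using f by (rule C_CP1_borel_measurable)
  have [measurable]: "cnj \<in> borel_measurable borel"
    by (intro borel_measurable_continuous_onI continuous_intros)
  show ?thesis
    unfolding berezin_def
  proof (rule has_int_iota_bounded[where K = K])
    fix s
    define q where "q = (cmod (1 + z * cnj s)) ^ (2 * \<tau>) / ((1 + (cmod z)^2) ^ \<tau> * (1 + (cmod s)^2) ^ \<tau>)"
    have pos: "(1 + (cmod z)^2) ^ \<tau> * (1 + (cmod s)^2) ^ \<tau> > 0"
      by (intro mult_pos_pos zero_less_power) (auto simp: add_pos_nonneg)
    have "(cmod (1 + z * cnj s))\<^sup>2 \<le> (1 + (cmod z)\<^sup>2) * (1 + (cmod s)\<^sup>2)"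
      using cmod_diff_squared_Lagrange[of s z] zero_le_power2[of "cmod (s - z)"]
      by (simp only: mult.commute)
    then have "((cmod (1 + z * cnj s))\<^sup>2) ^ \<tau> \<le> ((1 + (cmod z)\<^sup>2) * (1 + (cmod s)\<^sup>2)) ^ \<tau>"
      by (rule power_mono) simp
    then have "q \<le> 1"
      unfolding q_def divide_le_eq_1_pos[OF pos] power_mult power_mult_distrib .
    moreover have "q \<ge> 0" using pos by (simp add: q_def)
    ultimately have "norm (complex_of_real q * f s) \<le> 1 * K"
      using K[of s] unfolding norm_mult by (intro mult_mono) auto
    then show "norm (complex_of_real ((cmod (1 + z * cnj s)) ^ (2 * \<tau>) /
      ((1 + (cmod z)^2) ^ \<tau> * (1 + (cmod s)^2) ^ \<tau>)) * f s) \<le> K * (1 + (cmod s)\<^sup>2) ^ 0"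
      by (simp only: q_def) simp
  qed measurable
qed

theorem mainTheorem3:
  fixes \<mu> \<nu> k :: nat and f :: "complex \<Rightarrow> complex"
  assumes "k \<le> \<mu>" and "\<mu> < \<nu>" and "f \<in> C_CP1"
  shows "E_op \<mu> \<nu> k f = (\<lambda>\<xi>. complex_of_real (Csq \<mu> \<nu> k) *
    (\<Sum>l=0..k. complex_of_real ((-1) ^ (k - l) * real ((\<nu> - k) choose (k - l))
        * (fact (\<nu> - k + l) * fact k) / (fact \<nu> * fact l)) * berezin (\<mu> - l) f \<xi>))"
proof
  fix \<xi>
  have k: "k \<le> \<mu>" "k \<le> \<nu>" using assms by auto
  define N where "N = \<mu> + \<nu> - 2 * k"
  define C where "C = complex_of_real (Cc \<mu> \<nu> k)"
  define G where "G = J_kernel \<mu> \<nu> k \<xi>"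
  define c where "c l = (-1) ^ (k - l) * real ((\<nu> - k) choose (k - l))
        * (fact (\<nu> - k + l) * fact k) / (fact \<nu> * fact l)" for l
  define B where "B = 1 + (cmod \<xi>)\<^sup>2"
  define A T where "A s = 1 + (cmod s)\<^sup>2" and "T s = (cmod (1 + \<xi> * cnj s))\<^sup>2" for s
  have B: "B > 0" and A: "A s > 0" for s by (simp_all add: A_def B_def add_pos_nonneg)
  have CC: "C * C = complex_of_real (Csq \<mu> \<nu> k)"
    using Csq_nonneg[OF k] by (simp add: C_def Cc_def flip: of_real_mult)
  have G: "G \<in> tpolys \<mu> \<nu>" unfolding G_def by (intro J_kernel_in_tpolys k)
  \<comment> \<open>On the diagonal, \<open>P_adj\<close> of the kernel function and evaluation of
    \<open>P_op\<close> at \<xi> both produce the same \<open>G\<close>, leaving a quadratic form of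
    the symbol operator at \<open>G\<close>.\<close>
  have "E_op \<mu> \<nu> k f \<xi> = C * inner_T \<mu> \<nu> (tensorI (Rstar \<mu> f) (\<lambda>z w. C * G z w)) G / complex_of_real (B ^ N)"
    unfolding E_op_def R_op_def T_op_def P_adj_kern[OF k] P_op_def J_op_eq_inner_T N_def C_def G_def B_def ..
  also have "inner_T \<mu> \<nu> (tensorI (Rstar \<mu> f) (\<lambda>z w. C * G z w)) G =
      1 / of_nat (\<mu> + 1) * int_iota \<mu> (\<lambda>s. f s * inner_H \<nu> (\<lambda>w. C * G s w) (G s))"
    by (rule inner_T_tensorI_Rstar[OF assms(3) tpolys_cmult[OF G] G])
  also have "(\<lambda>s. f s * inner_H \<nu> (\<lambda>w. C * G s w) (G s)) = (\<lambda>s. C * (f s * inner_H \<nu> (G s) (G s)))"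
    using inner_H_cmult[of \<nu> C _ 1] by (simp add: mult_ac)
  also have "int_iota \<mu> (\<lambda>s. C * (f s * inner_H \<nu> (G s) (G s))) = of_nat (\<mu> + 1) * complex_of_real (B ^ N) * C *
      (\<Sum>l=0..k. complex_of_real (c l) * berezin (\<mu> - l) f \<xi>)"
  proof -
    let ?b = "\<lambda>l s. complex_of_real ((cmod (1 + \<xi> * cnj s)) ^ (2 * (\<mu> - l)) /
      ((1 + (cmod \<xi>)^2) ^ (\<mu> - l) * (1 + (cmod s)^2) ^ (\<mu> - l))) * f s"
    \<comment> \<open>The extra \<open>A s ^ \<mu>\<close> in the weight of index \<mu> supplies the
      denominators in \<open>s\<close> of the Berezin kernels relative to the weight of index
      0.\<close>
    have pointwise: "iota_w \<mu> s * (T s ^ (\<mu> - k) * (\<Sum>l=0..k. c l * (T s ^ (k - l) * A s ^ l * B ^ (\<nu> - k - (k - l))))) =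
        real (\<mu> + 1) * B ^ N * (iota_w 0 s * (\<Sum>l=0..k. c l * (T s ^ (\<mu> - l) / (B ^ (\<mu> - l) * A s ^ (\<mu> - l)))))" for s
    proof -
      have w: "iota_w \<mu> s = real (\<mu> + 1) * iota_w 0 s / A s ^ \<mu>"
        by (simp add: iota_w_def A_def power_add)
      \<comment> \<open>If \<open>k - l > \<nu> - k\<close>, the exponent of \<open>B\<close> is
        truncated but \<open>c l\<close> is 0. Otherwise the exponent of \<open>B\<close>, increased
        by \<open>\<mu> - l\<close>, is \<open>N\<close> for every \<open>l\<close>, which gives a
        common factor \<open>B ^ N\<close>.\<close>
      have "c l * (T s ^ (k - l) * A s ^ l * B ^ (\<nu> - k - (k - l))) * T s ^ (\<mu> - k) / A s ^ \<mu> =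
          B ^ N * (c l * (T s ^ (\<mu> - l) / (B ^ (\<mu> - l) * A s ^ (\<mu> - l))))" if "l \<in> {0..k}" for l
      proof (cases "k - l \<le> \<nu> - k")
        case True
        have "\<mu> - l = (k - l) + (\<mu> - k)" "N = (\<nu> - k - (k - l)) + (\<mu> - l)" "\<mu> = l + (\<mu> - l)"
          using that k True by (auto simp: N_def)
        then have "T s ^ (\<mu> - l) = T s ^ (k - l) * T s ^ (\<mu> - k)"
           "B ^ N = B ^ (\<nu> - k - (k - l)) * B ^ (\<mu> - l)" "A s ^ \<mu> = A s ^ l * A s ^ (\<mu> - l)"
          by (metis power_add)+
        then show ?thesis using A[of s] B by simp
      qed (simp add: c_def binomial_eq_0)
      then have "(\<Sum>l=0..k. c l * (T s ^ (k - l) * A s ^ l * B ^ (\<nu> - k - (k - l))) * T s ^ (\<mu> - k) / A s ^ \<mu>) =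
          (\<Sum>l=0..k. B ^ N * (c l * (T s ^ (\<mu> - l) / (B ^ (\<mu> - l) * A s ^ (\<mu> - l)))))"
        by (rule sum.cong[OF refl])
      then have "T s ^ (\<mu> - k) * (\<Sum>l=0..k. c l * (T s ^ (k - l) * A s ^ l * B ^ (\<nu> - k - (k - l)))) / A s ^ \<mu> =
          B ^ N * (\<Sum>l=0..k. c l * (T s ^ (\<mu> - l) / (B ^ (\<mu> - l) * A s ^ (\<mu> - l))))"
        by (simp only: sum_distrib_left sum_divide_distrib mult_ac)
      then show ?thesis
        unfolding w times_divide_eq_left mult.assoc times_divide_eq_right[symmetric]
        by (simp only: mult.left_commute[of "iota_w 0 s"])
    qed
    have norm_G: "inner_H \<nu> (G s) (G s) =
        complex_of_real (T s ^ (\<mu> - k) * (\<Sum>l=0..k. c l * (T s ^ (k - l) * A s ^ l * B ^ (\<nu> - k - (k - l)))))" for s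
      unfolding G_def inner_H_J_kernel[OF k] c_def T_def A_def B_def ..
    have b: "?b l s = complex_of_real (T s ^ (\<mu> - l) / (B ^ (\<mu> - l) * A s ^ (\<mu> - l))) * f s" for l s
      by (simp only: T_def A_def B_def power_mult)
    have "complex_of_real (iota_w \<mu> s) * (C * (f s * inner_H \<nu> (G s) (G s))) =
      (of_nat (\<mu> + 1) * complex_of_real (B ^ N) * C) * (complex_of_real (iota_w 0 s) * (\<Sum>l=0..k. complex_of_real (c l) * ?b l s))" for s
    proof -
      have "complex_of_real (iota_w \<mu> s) * (C * (f s * inner_H \<nu> (G s) (G s))) =
        C * f s * complex_of_real (iota_w \<mu> s * (T s ^ (\<mu> - k) * (\<Sum>l=0..k. c l * (T s ^ (k - l) * A s ^ l * B ^ (\<nu> - k - (k - l))))))"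
        unfolding norm_G by (simp only: of_real_mult mult_ac)
      also have "\<dots> = (of_nat (\<mu> + 1) * complex_of_real (B ^ N) * C) * (complex_of_real (iota_w 0 s) *
         (f s * complex_of_real (\<Sum>l=0..k. c l * (T s ^ (\<mu> - l) / (B ^ (\<mu> - l) * A s ^ (\<mu> - l))))))"
        unfolding pointwise by (simp only: of_real_mult of_real_of_nat_eq mult_ac)
      also have "f s * complex_of_real (\<Sum>l=0..k. c l * (T s ^ (\<mu> - l) / (B ^ (\<mu> - l) * A s ^ (\<mu> - l)))) =
          (\<Sum>l=0..k. complex_of_real (c l) * ?b l s)"
        unfolding b by (simp only: of_real_sum sum_distrib_left of_real_mult mult_ac)
      finally show ?thesis .
    qed
    then have "int_iota \<mu> (\<lambda>s. C * (f s * inner_H \<nu> (G s) (G s))) =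
      (of_nat (\<mu> + 1) * complex_of_real (B ^ N) * C) * int_iota 0 (\<lambda>s. \<Sum>l=0..k. complex_of_real (c l) * ?b l s)"
      unfolding int_iota_def by (simp only: integral_mult_right_zero)
    also have "int_iota 0 (\<lambda>s. \<Sum>l=0..k. complex_of_real (c l) * ?b l s) = (\<Sum>l=0..k. complex_of_real (c l) * berezin (\<mu> - l) f \<xi>)"
      by (intro has_int_iota_imp_eq has_int_iota_sum has_int_iota_cmult has_int_iota_berezin assms)
    finally show ?thesis .
  qed
  \<comment> \<open>The normalisations of \<open>Rstar\<close> and \<open>R_op\<close> cancel
    \<open>\<mu> + 1\<close> and \<open>B ^ N\<close>. The two factors \<open>C\<close>, one from
    \<open>P_op\<close> and one from its adjoint, combine to \<open>Csq\<close>.\<close>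
  also have "C * (1 / of_nat (\<mu> + 1) * (of_nat (\<mu> + 1) * complex_of_real (B ^ N) * C *
      (\<Sum>l=0..k. complex_of_real (c l) * berezin (\<mu> - l) f \<xi>))) / complex_of_real (B ^ N) =
      (C * C) * (\<Sum>l=0..k. complex_of_real (c l) * berezin (\<mu> - l) f \<xi>)"
  proof -
    have "C * (1 / m * (m * D * C * S)) / D = C * C * S" if "m \<noteq> 0" "D \<noteq> 0" for m D S
      using that by simp
    moreover have "complex_of_real (B ^ N) \<noteq> 0" using B by simp
    moreover have "(of_nat (\<mu> + 1) :: complex) \<noteq> 0" by (simp only: of_nat_eq_0_iff)
    ultimately show ?thesis by blast
  qed
  finally show "E_op \<mu> \<nu> k f \<xi> = complex_of_real (Csq \<mu> \<nu> k) *
    (\<Sum>l=0..k. complex_of_real ((-1) ^ (k - l) * real ((\<nu> - k) choose (k - l))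
        * (fact (\<nu> - k + l) * fact k) / (fact \<nu> * fact l)) * berezin (\<mu> - l) f \<xi>)"
    by (simp only: CC c_def)
qed

end
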